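(* Let $G$ be a member of a (not necessarily irreducible) real reductive dual pair, with a maximal compact subgroup $K$, and let $\mathfrak{g}$ be the complexified Lie algebra of $G$. If $\pi$ is an irreducible $(\mathfrak{g},K)$-module, and $\sigma,\sigma'\in\mathcal{R}(K,\pi)$, then $\varepsilon(\sigma)=\varepsilon(\sigma')$, where $\varepsilon:\mathcal{R}(K)\to\mathbb{Z}/2\mathbb{Z}$ is the parity of $K$-types.
   Context: A real reductive dual pair is a pair $(G,G')$ of closed reductive subgroups of $Sp_{2N}(\mathbb{R})$ (for some $N$) which are mutual centralizers of each other. Every such pair is a direct sum of irreducible ones, so $G=G_{1}\times\cdots\times G_{r}$ with each $G_{i}$ a member of an irreducible pair; by the classification, each $G_{i}$ is isomorphic to one of the following groups, with maximal compact subgroup $K_{i}$ in its usual embedding: $GL_{m}(\mathbb{R})\supset O(m)$; $GL_{m}(\mathbb{C})\supset U(m)$; $GL_{m}(\mathbb{H})\supset Sp(m)$; $O_{p}(\mathbb{C})\supset O(p)$; $O(p,q)\supset O(p)\times O(q)$; $Sp(p,q)\supset Sp(p)\times Sp(q)$; $U(p,q)\supset U(p)\times U(q)$; $Sp_{2n}(\mathbb{C})\supset Sp(n)$; $Sp_{2n}(\mathbb{R})\supset U(n)$; $O^{*}(2n)\supset U(n)$. Identify $(G,K)$ with $(G_{1}\times\cdots\times G_{r},K_{1}\times\cdots\times K_{r})$ via such isomorphisms; parity of $K$-types is defined through this identification. A $K$-type is an equivalence class of irreducible continuous $K$-modules; $\mathcal{R}(K)$ is the set of $K$-types. For a $(\mathfrak{g},K)$-module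 $V$, $\mathcal{R}(K,V)$ is the set of $K$-types $\sigma$ with $\mathrm{Hom}_{K}(\sigma,V)\neq0$. $[t]$ denotes the greatest integer $\le t$. Parametrization of $K$-types. $K=U(n)$: with the diagonal maximal torus $U(1)^{n}$ and positive roots $\{e_{i}-e_{j}: i<j\}$, a $U(n)$-type is parametrized by its highest weight $(a_{1},\dots,a_{n})$, integers $a_{1}\geqslant\cdots\geqslant a_{n}$. $K=Sp(n)$ (compact): with the standard maximal torus $U(1)^{n}$ and positive roots $\{e_{i}\pm e_{j}: i<j\}\cup\{2e_{i}\}$, an $Sp(n)$-type is parametrized by its highest weight $(a_{1},\dots,a_{n})$, integers $a_{1}\geqslant\cdots\geqslant a_{n}\geqslant0$. $K=O(n)$: embed $O(n)=U(n)\cap GL(n,\mathbb{R})$. There is a bijection (Weyl) between $\mathcal{R}(O(n))$ and the set of $U(n)$-types with highest weight $(b_{1},\dots,b_{r},\underbrace{1,\dots,1}_{s},\underbrace{0,\dots,0}_{n-r-s})$, $b_{r}\geqslant2$, $2r+s\leqslant n$; the $O(n)$-type $\sigma$ corresponds to the $U(n)$-type $\lambda$ when the highest weight vectors of $\lambda$ generate an $O(n)$-module equivalent to $\sigma$. Here highest weight vectors are taken with respect to a Borel subgroup of $GL_{n}(\mathbb{C})$ stabilizing a complete flag $F_{1}\subset\cdots\subset F_{n}=\mathbb{C}^{n}$ with $F_{n-i}=F_{i}^{\perp}$ for the complex bilinear form preserved by $O(n)$. An $O(n)$-type is then parametrized as $(a_{1},\dots,a_{[n/2]};\epsilon)$ with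 integers $a_{1}\geqslant\cdots\geqslant a_{[n/2]}\geqslant0$ and $\epsilon\in\{\pm1\}$: if $x=|\{i:a_{i}>0\}|$, the corresponding $U(n)$-type is $(a_{1},\dots,a_{x},\underbrace{1,\dots,1}_{\frac{1-\epsilon}{2}(n-2x)},0,\dots,0)$. When $n=2x$ the two choices of $\epsilon$ give the same $O(n)$-type; otherwise the parametrization is unique. Parity. For $K=U(n)$ or $Sp(n)$ and $\sigma=(a_{1},\dots,a_{n})$, $\varepsilon(\sigma)=\sum_{i=1}^{n}a_{i}\pmod 2$. For $K=O(n)$ and $\sigma=(a_{1},\dots,a_{[n/2]};\epsilon)$, $\varepsilon(\sigma)=\sum_{i=1}^{[n/2]}a_{i}+\frac{1-\epsilon}{2}\cdot n\pmod 2$ (well defined). For a product $K=K_{1}\times\cdots\times K_{r}$ with each $K_{i}$ one of (or a product of groups of the form) $U(n_{i}),Sp(n_{i}),O(n_{i})$, and $\sigma=\bigotimes_{i}\sigma_{i}$ with $\sigma_i\in\mathcal{R}(K_i)$, $\varepsilon(\sigma)=\sum_{i=1}^{r}\varepsilon(\sigma_{i})\in\mathbb{Z}/2\mathbb{Z}$. *)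

theory Defs
  imports
    "Jordan_Normal_Form.Matrix"
    "Jordan_Normal_Form.Schur_Decomposition"
    "HOL-Algebra.Product_Groups"
    "HOL-Library.Function_Algebras"
    "HOL-Library.Z2"
    "HOL-Analysis.Analysis"
begin

no_notation vec_index (infixl "$" 100)
hide_const (open) Matrix.mat

section \<open>Reductive dual pairs\<close>

definition rmat_group :: "(real^'m^'m) set \<Rightarrow> (real^'m^'m) monoid" where
  "rmat_group S = \<lparr>carrier = S, monoid.mult = (**), one = Finite_Cartesian_Product.mat 1\<rparr>"

definition sympl_form :: "real^('n::finite + 'n)^('n + 'n)" where
  "sympl_form = (\<chi> i j. case (i, j) of
       (Inl a, Inr b) \<Rightarrow> (if a = b then 1 else 0)
     | (Inr a, Inl b) \<Rightarrow> (if a = b then -1 else 0)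
     | _ \<Rightarrow> 0)"

definition Sp_real :: "(real^('n::finite + 'n)^('n + 'n)) set" where
  "Sp_real = {A. Finite_Cartesian_Product.transpose A ** sympl_form ** A = sympl_form}"

definition centralizer_in :: "(real^'m^'m) set \<Rightarrow> (real^'m^'m) set \<Rightarrow> (real^'m^'m) set" where
  "centralizer_in S H = {g \<in> S. \<forall>h\<in>H. g ** h = h ** g}"

text \<open>A subgroup of the symplectic group counts as reductive if its action on the symplectic
  space is completely reducible (Howe's definition of a reductive dual pair).\<close>

definition acts_reductively :: "(real^'m^'m) set \<Rightarrow> bool" where
  "acts_reductively G \<longleftrightarrow>
     (\<forall>U. subspace U \<and> (\<forall>g\<in>G. \<forall>u\<in>U. g *v u \<in> U) \<longrightarrow>
        (\<exists>U'. subspace U' \<and> (\<forall>g\<in>G. \<forall>u\<in>U'. g *v u \<in> U') \<and>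
              U \<inter> U' = {0} \<and> (\<forall>x. \<exists>u\<in>U. \<exists>u'\<in>U'. x = u + u')))"

definition closed_reductive_subgroup :: "(real^('n::finite + 'n)^('n + 'n)) set \<Rightarrow> bool" where
  "closed_reductive_subgroup G \<longleftrightarrow>
     subgroup G (rmat_group Sp_real) \<and> closed G \<and> acts_reductively G"

definition reductive_dual_pair ::
  "(real^('n::finite + 'n)^('n + 'n)) set \<Rightarrow> (real^('n + 'n)^('n + 'n)) set \<Rightarrow> bool" where
  "reductive_dual_pair G G' \<longleftrightarrow>
     closed_reductive_subgroup G \<and> closed_reductive_subgroup G' \<and>
     G' = centralizer_in Sp_real G \<and> G = centralizer_in Sp_real G'"

definition maximal_compact_subgroup :: "(real^'m^'m) set \<Rightarrow> (real^'m^'m) set \<Rightarrow> bool" where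
  "maximal_compact_subgroup K G \<longleftrightarrow>
     subgroup K (rmat_group G) \<and> compact K \<and>
     (\<forall>H. subgroup H (rmat_group G) \<and> compact H \<and> K \<subseteq> H \<longrightarrow> H = K)"


section \<open>Lie algebras of real matrix groups\<close>

definition mexp :: "real^'m^'m \<Rightarrow> real^'m^'m" where
  "mexp X = (\<chi> i j. \<Sum>k. (((**) X ^^ k) (Finite_Cartesian_Product.mat 1)) $ i $ j / fact k)"

definition lie_algebra :: "(real^'m^'m) set \<Rightarrow> (real^'m^'m) set" where
  "lie_algebra G = {X. \<forall>t. mexp (t *\<^sub>R X) \<in> G}"

definition Re_mat :: "complex^'m^'m \<Rightarrow> real^'m^'m" where
  "Re_mat Z = (\<chi> i j. Re (Z $ i $ j))"

definition Im_mat :: "complex^'m^'m \<Rightarrow> real^'m^'m" where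
  "Im_mat Z = (\<chi> i j. Im (Z $ i $ j))"

definition of_real_mat :: "real^'m^'m \<Rightarrow> complex^'m^'m" where
  "of_real_mat X = (\<chi> i j. complex_of_real (X $ i $ j))"

definition scale_mat :: "complex \<Rightarrow> complex^'m^'m \<Rightarrow> complex^'m^'m" where
  "scale_mat c Z = (\<chi> i j. c * Z $ i $ j)"

text \<open>For a Lie algebra \<open>L\<close> of real matrices, the complexification is the space
  \<open>L + \<i> L\<close> of complex matrices.\<close>

definition cplx_lie_algebra :: "(real^'m^'m) set \<Rightarrow> (complex^'m^'m) set" where
  "cplx_lie_algebra G = {Z. Re_mat Z \<in> lie_algebra G \<and> Im_mat Z \<in> lie_algebra G}"

definition lie_bracket :: "complex^'m^'m \<Rightarrow> complex^'m^'m \<Rightarrow> complex^'m^'m" where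
  "lie_bracket Y Z = Y ** Z - Z ** Y"

definition Ad :: "real^'m^'m \<Rightarrow> complex^'m^'m \<Rightarrow> complex^'m^'m" where
  "Ad k Z = of_real_mat k ** Z ** of_real_mat (matrix_inv k)"


section \<open>Representations\<close>

text \<open>Representations live on subspaces \<open>W\<close> of a complex vector space with scalar
  multiplication \<open>s\<close>; only the values of \<open>\<rho>\<close> on the carrier of the group and on \<open>W\<close> matter.\<close>

definition linear_between ::
  "(complex \<Rightarrow> 'v \<Rightarrow> 'v) \<Rightarrow> 'v::ab_group_add set \<Rightarrow> (complex \<Rightarrow> 'w \<Rightarrow> 'w) \<Rightarrow> 'w::ab_group_add set
    \<Rightarrow> ('v \<Rightarrow> 'w) \<Rightarrow> bool" where
  "linear_between s W s' W' T \<longleftrightarrow>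
     T \<in> W \<rightarrow> W' \<and> (\<forall>u\<in>W. \<forall>v\<in>W. T (u + v) = T u + T v) \<and> (\<forall>c. \<forall>v\<in>W. T (s c v) = s' c (T v))"

definition group_rep ::
  "'g monoid \<Rightarrow> (complex \<Rightarrow> 'v \<Rightarrow> 'v) \<Rightarrow> 'v::ab_group_add set \<Rightarrow> ('g \<Rightarrow> 'v \<Rightarrow> 'v) \<Rightarrow> bool" where
  "group_rep H s W \<rho> \<longleftrightarrow>
     module.subspace s W \<and>
     (\<forall>g\<in>carrier H. linear_between s W s W (\<rho> g)) \<and>
     (\<forall>v\<in>W. \<rho> \<one>\<^bsub>H\<^esub> v = v) \<and>
     (\<forall>g\<in>carrier H. \<forall>h\<in>carrier H. \<forall>v\<in>W. \<rho> (g \<otimes>\<^bsub>H\<^esub> h) v = \<rho> g (\<rho> h v))"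

text \<open>Continuity is tested on matrix coefficients.\<close>

definition fd_continuous_rep ::
  "'g monoid \<Rightarrow> 'g topology \<Rightarrow> (complex \<Rightarrow> 'v \<Rightarrow> 'v) \<Rightarrow> 'v::ab_group_add set
    \<Rightarrow> ('g \<Rightarrow> 'v \<Rightarrow> 'v) \<Rightarrow> bool" where
  "fd_continuous_rep H \<T> s W \<rho> \<longleftrightarrow>
     group_rep H s W \<rho> \<and> (\<exists>B. finite B \<and> W = module.span s B) \<and>
     (\<forall>v\<in>W. \<forall>f. Vector_Spaces.linear s (*) f \<longrightarrow> continuous_map \<T> euclidean (\<lambda>g. f (\<rho> g v)))"

definition irreducible_rep ::
  "'g monoid \<Rightarrow> (complex \<Rightarrow> 'v \<Rightarrow> 'v) \<Rightarrow> 'v::ab_group_add set \<Rightarrow> ('g \<Rightarrow> 'v \<Rightarrow> 'v) \<Rightarrow> bool" where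
  "irreducible_rep H s W \<rho> \<longleftrightarrow>
     W \<noteq> {0} \<and>
     (\<forall>U. module.subspace s U \<and> U \<subseteq> W \<and> (\<forall>g\<in>carrier H. \<forall>u\<in>U. \<rho> g u \<in> U) \<longrightarrow> U = {0} \<or> U = W)"

text \<open>Irreducible continuous modules of a compact group are finite-dimensional, so up to
  equivalence they all live on subspaces of \<open>nat \<Rightarrow> complex\<close>.\<close>

type_synonym 'g crep = "(nat \<Rightarrow> complex) set \<times> ('g \<Rightarrow> (nat \<Rightarrow> complex) \<Rightarrow> nat \<Rightarrow> complex)"

definition fscale :: "complex \<Rightarrow> (nat \<Rightarrow> complex) \<Rightarrow> nat \<Rightarrow> complex" where
  "fscale c f = (\<lambda>i. c * f i)"

definition irreps :: "'g monoid \<Rightarrow> 'g topology \<Rightarrow> 'g crep set" where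
  "irreps H \<T> = {(W, \<rho>). fd_continuous_rep H \<T> fscale W \<rho> \<and> irreducible_rep H fscale W \<rho>}"

definition equivalent_reps :: "'g monoid \<Rightarrow> 'g crep \<Rightarrow> 'g crep \<Rightarrow> bool" where
  "equivalent_reps H = (\<lambda>(W, \<rho>) (W', \<rho>').
     \<exists>T. linear_between fscale W fscale W' T \<and> bij_betw T W W' \<and>
         (\<forall>g\<in>carrier H. \<forall>v\<in>W. T (\<rho> g v) = \<rho>' g (T v)))"

definition K_types :: "'g monoid \<Rightarrow> 'g topology \<Rightarrow> 'g crep set set" where
  "K_types H \<T> =
     irreps H \<T> // {(R, R'). R \<in> irreps H \<T> \<and> R' \<in> irreps H \<T> \<and> equivalent_reps H R R'}"


section \<open>(g, K)-modules\<close>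

text \<open>\<open>\<pi>\<close> is the action of \<open>K\<close> and \<open>\<alpha>\<close> that of the complexified Lie algebra of \<open>G\<close>.  The last
  three conditions are: \<open>K\<close>-finiteness (with continuity), the differential of \<open>\<pi>\<close> is the
  restriction of \<open>\<alpha>\<close>, and \<open>\<alpha>\<close> is \<open>K\<close>-equivariant.\<close>

definition gK_module ::
  "(real^'m^'m) set \<Rightarrow> (real^'m^'m) set \<Rightarrow> (complex \<Rightarrow> 'v \<Rightarrow> 'v) \<Rightarrow>
    (complex^'m^'m \<Rightarrow> 'v \<Rightarrow> 'v) \<Rightarrow> (real^'m^'m \<Rightarrow> 'v::ab_group_add \<Rightarrow> 'v) \<Rightarrow> bool" where
  "gK_module G K s \<alpha> \<pi> \<longleftrightarrow>
     vector_space s \<and>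
     (\<forall>Z\<in>cplx_lie_algebra G. linear_between s UNIV s UNIV (\<alpha> Z)) \<and>
     (\<forall>Y\<in>cplx_lie_algebra G. \<forall>Z\<in>cplx_lie_algebra G. \<forall>v. \<alpha> (Y + Z) v = \<alpha> Y v + \<alpha> Z v) \<and>
     (\<forall>c. \<forall>Z\<in>cplx_lie_algebra G. \<forall>v. \<alpha> (scale_mat c Z) v = s c (\<alpha> Z v)) \<and>
     (\<forall>Y\<in>cplx_lie_algebra G. \<forall>Z\<in>cplx_lie_algebra G. \<forall>v.
        \<alpha> (lie_bracket Y Z) v = \<alpha> Y (\<alpha> Z v) - \<alpha> Z (\<alpha> Y v)) \<and>
     group_rep (rmat_group K) s UNIV \<pi> \<and>
     (\<forall>v. \<exists>W. v \<in> W \<and> fd_continuous_rep (rmat_group K) (top_of_set K) s W \<pi>) \<and>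
     (\<forall>X\<in>lie_algebra K. \<forall>v f. Vector_Spaces.linear s (*) f \<longrightarrow>
        ((\<lambda>t. f (\<pi> (mexp (t *\<^sub>R X)) v)) has_vector_derivative f (\<alpha> (of_real_mat X) v)) (at 0)) \<and>
     (\<forall>k\<in>K. \<forall>Z\<in>cplx_lie_algebra G. \<forall>v. \<pi> k (\<alpha> Z v) = \<alpha> (Ad k Z) (\<pi> k v))"

definition irreducible_gK_module ::
  "(real^'m^'m) set \<Rightarrow> (real^'m^'m) set \<Rightarrow> (complex \<Rightarrow> 'v \<Rightarrow> 'v) \<Rightarrow>
    (complex^'m^'m \<Rightarrow> 'v \<Rightarrow> 'v) \<Rightarrow> (real^'m^'m \<Rightarrow> 'v::ab_group_add \<Rightarrow> 'v) \<Rightarrow> bool" where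
  "irreducible_gK_module G K s \<alpha> \<pi> \<longleftrightarrow>
     gK_module G K s \<alpha> \<pi> \<and> (UNIV :: 'v set) \<noteq> {0} \<and>
     (\<forall>U. module.subspace s U \<and> (\<forall>Z\<in>cplx_lie_algebra G. \<forall>u\<in>U. \<alpha> Z u \<in> U) \<and>
          (\<forall>k\<in>K. \<forall>u\<in>U. \<pi> k u \<in> U) \<longrightarrow> U = {0} \<or> U = UNIV)"

definition K_types_of ::
  "(real^'m^'m) set \<Rightarrow> (complex \<Rightarrow> 'v \<Rightarrow> 'v) \<Rightarrow> (real^'m^'m \<Rightarrow> 'v::ab_group_add \<Rightarrow> 'v)
    \<Rightarrow> (real^'m^'m) crep set set" where
  "K_types_of K s \<pi> = {\<sigma> \<in> K_types (rmat_group K) (top_of_set K).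
     \<exists>(W, \<rho>)\<in>\<sigma>. \<exists>T. linear_between fscale W s UNIV T \<and>
        (\<forall>k\<in>K. \<forall>w\<in>W. T (\<rho> k w) = \<pi> k (T w)) \<and> (\<exists>w\<in>W. T w \<noteq> 0)}"


section \<open>Classical groups\<close>

text \<open>The classical groups have varying sizes, so they consist of matrices over the type
  \<^typ>\<open>complex Matrix.mat\<close>, topologised through their entries.\<close>

definition mat_topology :: "nat \<Rightarrow> complex Matrix.mat topology" where
  "mat_topology n = pullback_topology (carrier_mat n n)
     (\<lambda>A i j. if i < n \<and> j < n then A $$ (i, j) else 0) euclidean"

definition cmat_group :: "nat \<Rightarrow> complex Matrix.mat set \<Rightarrow> complex Matrix.mat monoid" where
  "cmat_group n S = \<lparr>carrier = S, monoid.mult = (*), one = 1\<^sub>m n\<rparr>"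

definition cnj_mat :: "complex Matrix.mat \<Rightarrow> complex Matrix.mat" where
  "cnj_mat A = map_mat cnj A"

definition GLC :: "nat \<Rightarrow> complex Matrix.mat set" where
  "GLC n = {A \<in> carrier_mat n n. invertible_mat A}"

definition GLR :: "nat \<Rightarrow> complex Matrix.mat set" where
  "GLR n = {A \<in> GLC n. cnj_mat A = A}"

text \<open>\<open>J_mat m\<close> has blocks \<open>0, 1, -1, 0\<close> and \<open>I_mat p q\<close> is the diagonal matrix of
  signature \<open>(p, q)\<close>.\<close>

definition J_mat :: "nat \<Rightarrow> complex Matrix.mat" where
  "J_mat m = four_block_mat (0\<^sub>m m m) (1\<^sub>m m) (- 1\<^sub>m m) (0\<^sub>m m m)"

definition dsum_mat :: "complex Matrix.mat \<Rightarrow> complex Matrix.mat \<Rightarrow> complex Matrix.mat" where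
  "dsum_mat A B = four_block_mat A (0\<^sub>m (dim_row A) (dim_col B)) (0\<^sub>m (dim_row B) (dim_col A)) B"

definition I_mat :: "nat \<Rightarrow> nat \<Rightarrow> complex Matrix.mat" where
  "I_mat p q = dsum_mat (1\<^sub>m p) (- 1\<^sub>m q)"

text \<open>Quaternionic matrices \<open>a + b j\<close> are written as complex matrices with blocks
  \<open>a, b, -cnj b, cnj a\<close>; these are the matrices \<open>A\<close> with \<open>A J = J (cnj A)\<close>.\<close>

definition GLH :: "nat \<Rightarrow> complex Matrix.mat set" where
  "GLH m = {A \<in> GLC (2 * m). A * J_mat m = J_mat m * cnj_mat A}"

datatype classical =
    GL_R nat | GL_C nat | GL_H nat | O_C nat | O_sig nat nat | Sp_sig nat nat | U_sig nat nat
  | Sp_C nat | Sp_R nat | O_star nat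

fun classical_size :: "classical \<Rightarrow> nat" where
  "classical_size (GL_R m) = m"
| "classical_size (GL_C m) = m"
| "classical_size (GL_H m) = 2 * m"
| "classical_size (O_C p) = p"
| "classical_size (O_sig p q) = p + q"
| "classical_size (Sp_sig p q) = 2 * (p + q)"
| "classical_size (U_sig p q) = p + q"
| "classical_size (Sp_C n) = 2 * n"
| "classical_size (Sp_R n) = 2 * n"
| "classical_size (O_star n) = 2 * n"

text \<open>\<open>Sp_C n\<close> and \<open>Sp_R n\<close> stand for \<open>Sp\<^sub>2\<^sub>n\<close> and \<open>O_star n\<close> for \<open>O\<^sup>*(2n)\<close>, the quaternionic
  matrices in \<open>O\<^sub>2\<^sub>n(\<complex>)\<close>.  \<open>Sp(p, q)\<close> is the isometry group of a quaternionic Hermitian form.\<close>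

fun classical_set :: "classical \<Rightarrow> complex Matrix.mat set" where
  "classical_set (GL_R m) = GLR m"
| "classical_set (GL_C m) = GLC m"
| "classical_set (GL_H m) = GLH m"
| "classical_set (O_C p) = {A \<in> GLC p. transpose_mat A * A = 1\<^sub>m p}"
| "classical_set (O_sig p q) = {A \<in> GLR (p + q). transpose_mat A * I_mat p q * A = I_mat p q}"
| "classical_set (Sp_sig p q) =
     {A \<in> GLH (p + q). mat_adjoint A * dsum_mat (I_mat p q) (I_mat p q) * A
                        = dsum_mat (I_mat p q) (I_mat p q)}"
| "classical_set (U_sig p q) = {A \<in> GLC (p + q). mat_adjoint A * I_mat p q * A = I_mat p q}"
| "classical_set (Sp_C n) = {A \<in> GLC (2 * n). transpose_mat A * J_mat n * A = J_mat n}"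
| "classical_set (Sp_R n) = {A \<in> GLR (2 * n). transpose_mat A * J_mat n * A = J_mat n}"
| "classical_set (O_star n) = {A \<in> GLH n. transpose_mat A * A = 1\<^sub>m (2 * n)}"

definition classical_group :: "classical \<Rightarrow> complex Matrix.mat monoid" where
  "classical_group c = cmat_group (classical_size c) (classical_set c)"

datatype compact_factor = U_cpt nat | Sp_cpt nat | O_cpt nat

fun compact_size :: "compact_factor \<Rightarrow> nat" where
  "compact_size (U_cpt n) = n"
| "compact_size (Sp_cpt n) = 2 * n"
| "compact_size (O_cpt n) = n"

fun compact_set :: "compact_factor \<Rightarrow> complex Matrix.mat set" where
  "compact_set (U_cpt n) = {A \<in> carrier_mat n n. mat_adjoint A * A = 1\<^sub>m n}"
| "compact_set (Sp_cpt n) = {A \<in> carrier_mat (2 * n) (2 * n).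
     mat_adjoint A * A = 1\<^sub>m (2 * n) \<and> transpose_mat A * J_mat n * A = J_mat n}"
| "compact_set (O_cpt n) = {A \<in> carrier_mat n n. cnj_mat A = A \<and> mat_adjoint A * A = 1\<^sub>m n}"

definition compact_group :: "compact_factor \<Rightarrow> complex Matrix.mat monoid" where
  "compact_group \<kappa> = cmat_group (compact_size \<kappa>) (compact_set \<kappa>)"

definition compact_irreps :: "compact_factor \<Rightarrow> complex Matrix.mat crep set" where
  "compact_irreps \<kappa> =
     irreps (compact_group \<kappa>) (subtopology (mat_topology (compact_size \<kappa>)) (compact_set \<kappa>))"

text \<open>The maximal compact subgroup of a classical group, as a list of factors together with its
  usual embedding.\<close>

fun compact_factors :: "classical \<Rightarrow> compact_factor list" where
  "compact_factors (GL_R m) = [O_cpt m]"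
| "compact_factors (GL_C m) = [U_cpt m]"
| "compact_factors (GL_H m) = [Sp_cpt m]"
| "compact_factors (O_C p) = [O_cpt p]"
| "compact_factors (O_sig p q) = [O_cpt p, O_cpt q]"
| "compact_factors (Sp_sig p q) = [Sp_cpt p, Sp_cpt q]"
| "compact_factors (U_sig p q) = [U_cpt p, U_cpt q]"
| "compact_factors (Sp_C n) = [Sp_cpt n]"
| "compact_factors (Sp_R n) = [U_cpt n]"
| "compact_factors (O_star n) = [U_cpt n]"

text \<open>Direct sum of quaternionic matrices of sizes \<open>p\<close> and \<open>q\<close>.\<close>

definition quat_dsum ::
  "nat \<Rightarrow> nat \<Rightarrow> complex Matrix.mat \<Rightarrow> complex Matrix.mat \<Rightarrow> complex Matrix.mat" where
  "quat_dsum p q A B =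
     (case split_block A p p of (A1, A2, A3, A4) \<Rightarrow>
      case split_block B q q of (B1, B2, B3, B4) \<Rightarrow>
        four_block_mat (dsum_mat A1 B1) (dsum_mat A2 B2) (dsum_mat A3 B3) (dsum_mat A4 B4))"

text \<open>The real form of a complex matrix \<open>a + \<i> b\<close>, with blocks \<open>a, b, -b, a\<close>.\<close>

definition real_form :: "complex Matrix.mat \<Rightarrow> complex Matrix.mat" where
  "real_form A =
     four_block_mat (map_mat (\<lambda>z. of_real (Re z)) A) (map_mat (\<lambda>z. of_real (Im z)) A)
                    (map_mat (\<lambda>z. - of_real (Im z)) A) (map_mat (\<lambda>z. of_real (Re z)) A)"

fun compact_embed :: "classical \<Rightarrow> (nat \<Rightarrow> complex Matrix.mat) \<Rightarrow> complex Matrix.mat" where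
  "compact_embed (O_sig p q) k = dsum_mat (k 0) (k 1)"
| "compact_embed (U_sig p q) k = dsum_mat (k 0) (k 1)"
| "compact_embed (Sp_sig p q) k = quat_dsum p q (k 0) (k 1)"
| "compact_embed (Sp_R n) k = real_form (k 0)"
| "compact_embed (O_star n) k = real_form (k 0)"
| "compact_embed _ k = k 0"

text \<open>A list \<open>cs\<close> of classical groups determines the product \<open>G\<^sub>1 \<times> \<dots> \<times> G\<^sub>r\<close>.  The group
  \<open>K\<^sub>1 \<times> \<dots> \<times> K\<^sub>r\<close> is indexed by the pairs \<open>(i, j)\<close>, the \<open>j\<close>-th compact factor of \<open>K\<^sub>i\<close>.\<close>

definition G_product :: "classical list \<Rightarrow> (nat \<Rightarrow> complex Matrix.mat) monoid" where
  "G_product cs = product_group {..<length cs} (\<lambda>i. classical_group (cs ! i))"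

definition G_product_topology :: "classical list \<Rightarrow> (nat \<Rightarrow> complex Matrix.mat) topology" where
  "G_product_topology cs = product_topology
     (\<lambda>i. subtopology (mat_topology (classical_size (cs ! i))) (classical_set (cs ! i)))
     {..<length cs}"

definition K_index :: "classical list \<Rightarrow> (nat \<times> nat) set" where
  "K_index cs = {(i, j). i < length cs \<and> j < length (compact_factors (cs ! i))}"

definition K_factor :: "classical list \<Rightarrow> nat \<times> nat \<Rightarrow> compact_factor" where
  "K_factor cs = (\<lambda>(i, j). compact_factors (cs ! i) ! j)"

definition K_product :: "classical list \<Rightarrow> (nat \<times> nat \<Rightarrow> complex Matrix.mat) monoid" where
  "K_product cs = product_group (K_index cs) (\<lambda>x. compact_group (K_factor cs x))"

definition K_embed ::
  "classical list \<Rightarrow> (nat \<times> nat \<Rightarrow> complex Matrix.mat) \<Rightarrow> nat \<Rightarrow> complex Matrix.mat" where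
  "K_embed cs k = (\<lambda>i\<in>{..<length cs}. compact_embed (cs ! i) (\<lambda>j. k (i, j)))"

definition classical_identification ::
  "classical list \<Rightarrow> ((nat \<Rightarrow> complex Matrix.mat) \<Rightarrow> real^'m^'m) \<Rightarrow>
    (real^'m^'m) set \<Rightarrow> (real^'m^'m) set \<Rightarrow> bool" where
  "classical_identification cs \<theta> G K \<longleftrightarrow>
     \<theta> \<in> iso (G_product cs) (rmat_group G) \<and>
     homeomorphic_map (G_product_topology cs) (top_of_set G) \<theta> \<and>
     K = \<theta> ` K_embed cs ` carrier (K_product cs)"


section \<open>Highest weights for U(n) and Sp(n)\<close>

text \<open>\<open>D t\<close> is the element of the maximal torus with parameters \<open>t\<^sub>0, \<dots>, t\<^sub>n\<^sub>-\<^sub>1\<close>.\<close>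

definition has_weight ::
  "((nat \<Rightarrow> complex) \<Rightarrow> complex Matrix.mat) \<Rightarrow> nat \<Rightarrow> complex Matrix.mat crep \<Rightarrow> int list \<Rightarrow> bool"
  where
  "has_weight D n = (\<lambda>(W, \<rho>) a. length a = n \<and>
     (\<exists>v\<in>W. v \<noteq> 0 \<and> (\<forall>t. (\<forall>i<n. norm (t i) = 1) \<longrightarrow>
        \<rho> (D t) v = fscale (\<Prod>i<n. t i powi (a ! i)) v)))"

text \<open>The highest weight is the weight that exceeds every other weight by a sum of positive
  roots.\<close>

definition highest_weight ::
  "((nat \<Rightarrow> complex) \<Rightarrow> complex Matrix.mat) \<Rightarrow> (nat \<Rightarrow> int) set \<Rightarrow> nat \<Rightarrow>
    complex Matrix.mat crep \<Rightarrow> int list \<Rightarrow> bool" where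
  "highest_weight D roots n R a \<longleftrightarrow>
     has_weight D n R a \<and>
     (\<forall>b. has_weight D n R b \<longrightarrow>
        (\<exists>c :: (nat \<Rightarrow> int) \<Rightarrow> nat. \<forall>k<n. a ! k - b ! k = (\<Sum>r\<in>roots. int (c r) * r k)))"

definition e_wt :: "nat \<Rightarrow> nat \<Rightarrow> int" where
  "e_wt i = (\<lambda>k. if k = i then 1 else 0)"

definition U_torus :: "nat \<Rightarrow> (nat \<Rightarrow> complex) \<Rightarrow> complex Matrix.mat" where
  "U_torus n t = mat_diag n t"

definition U_roots :: "nat \<Rightarrow> (nat \<Rightarrow> int) set" where
  "U_roots n = {e_wt i - e_wt j | i j. i < j \<and> j < n}"

definition U_type :: "nat \<Rightarrow> complex Matrix.mat crep \<Rightarrow> int list \<Rightarrow> bool" where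
  "U_type n R a \<longleftrightarrow>
     R \<in> compact_irreps (U_cpt n) \<and> sorted_wrt (\<ge>) a \<and> highest_weight (U_torus n) (U_roots n) n R a"

definition Sp_torus :: "nat \<Rightarrow> (nat \<Rightarrow> complex) \<Rightarrow> complex Matrix.mat" where
  "Sp_torus n t = mat_diag (2 * n) (\<lambda>i. if i < n then t i else cnj (t (i - n)))"

definition Sp_roots :: "nat \<Rightarrow> (nat \<Rightarrow> int) set" where
  "Sp_roots n = {e_wt i - e_wt j | i j. i < j \<and> j < n} \<union> {e_wt i + e_wt j | i j. i < j \<and> j < n}
     \<union> {2 * e_wt i | i. i < n}"

definition Sp_type :: "nat \<Rightarrow> complex Matrix.mat crep \<Rightarrow> int list \<Rightarrow> bool" where
  "Sp_type n R a \<longleftrightarrow>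
     R \<in> compact_irreps (Sp_cpt n) \<and> sorted_wrt (\<ge>) a \<and> (\<forall>x\<in>set a. 0 \<le> x) \<and>
     highest_weight (Sp_torus n) (Sp_roots n) n R a"


section \<open>Weyl's parametrization for O(n)\<close>

definition cvec_subspace :: "nat \<Rightarrow> complex Matrix.vec set \<Rightarrow> bool" where
  "cvec_subspace n U \<longleftrightarrow> U \<subseteq> carrier_vec n \<and> 0\<^sub>v n \<in> U \<and>
     (\<forall>u\<in>U. \<forall>v\<in>U. u + v \<in> U) \<and> (\<forall>c. \<forall>u\<in>U. c \<cdot>\<^sub>v u \<in> U)"

text \<open>A strictly increasing chain of \<open>n + 1\<close> subspaces of \<open>\<complex>\<^sup>n\<close> is a complete flag.\<close>

definition complete_flag :: "nat \<Rightarrow> (nat \<Rightarrow> complex Matrix.vec set) \<Rightarrow> bool" where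
  "complete_flag n F \<longleftrightarrow>
     (\<forall>i\<le>n. cvec_subspace n (F i)) \<and> (\<forall>i<n. F i \<subset> F (Suc i))"

text \<open>Here \<open>\<bullet>\<close> is the complex bilinear form preserved by \<open>O(n)\<close>.\<close>

definition orthogonal_flag :: "nat \<Rightarrow> (nat \<Rightarrow> complex Matrix.vec set) \<Rightarrow> bool" where
  "orthogonal_flag n F \<longleftrightarrow> complete_flag n F \<and>
     (\<forall>i\<le>n. F (n - i) = {v \<in> carrier_vec n. \<forall>w\<in>F i. v \<bullet> w = 0})"

definition flag_borel :: "nat \<Rightarrow> (nat \<Rightarrow> complex Matrix.vec set) \<Rightarrow> complex Matrix.mat set" where
  "flag_borel n F = {X \<in> carrier_mat n n. \<forall>i\<le>n. \<forall>v\<in>F i. X *\<^sub>v v \<in> F i}"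

definition cmat_exp :: "nat \<Rightarrow> complex Matrix.mat \<Rightarrow> complex Matrix.mat" where
  "cmat_exp n X = Matrix.mat n n (\<lambda>ij. \<Sum>k. (X ^\<^sub>m k) $$ ij / fact k)"

definition u_algebra :: "nat \<Rightarrow> complex Matrix.mat set" where
  "u_algebra n = {X \<in> carrier_mat n n. mat_adjoint X = - X}"

text \<open>\<open>w\<close> is the image of \<open>v\<close> under the differential of the representation at \<open>X\<close>.\<close>

definition diff_rep ::
  "nat \<Rightarrow> complex Matrix.mat crep \<Rightarrow> complex Matrix.mat \<Rightarrow> (nat \<Rightarrow> complex) \<Rightarrow> (nat \<Rightarrow> complex) \<Rightarrow> bool"
  where
  "diff_rep n = (\<lambda>(W, \<rho>) X v w. w \<in> W \<and>
     (\<forall>f. Vector_Spaces.linear fscale (*) f \<longrightarrow>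
        ((\<lambda>t. f (\<rho> (cmat_exp n (complex_of_real t \<cdot>\<^sub>m X)) v)) has_vector_derivative f w) (at 0)))"

text \<open>The highest weight vectors of a \<open>U(n)\<close>-module for the Borel subgroup of \<open>GL\<^sub>n(\<complex>)\<close>
  stabilizing \<open>F\<close> span lines stable under its Lie algebra \<open>flag_borel n F\<close>, which acts through
  \<open>gl\<^sub>n(\<complex>) = u(n) + \<i> u(n)\<close> by the complex linear extension of the differential.\<close>

definition hw_vector ::
  "nat \<Rightarrow> (nat \<Rightarrow> complex Matrix.vec set) \<Rightarrow> complex Matrix.mat crep \<Rightarrow> (nat \<Rightarrow> complex) \<Rightarrow> bool"
  where
  "hw_vector n F R v \<longleftrightarrow> v \<in> fst R \<and> v \<noteq> 0 \<and>
     (\<forall>A\<in>u_algebra n. \<forall>B\<in>u_algebra n. A + \<i> \<cdot>\<^sub>m B \<in> flag_borel n F \<longrightarrow>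
        (\<exists>vA vB c. diff_rep n R A v vA \<and> diff_rep n R B v vB \<and> vA + fscale \<i> vB = fscale c v))"

definition hw_generated :: "nat \<Rightarrow> (nat \<Rightarrow> complex Matrix.vec set) \<Rightarrow> complex Matrix.mat crep
    \<Rightarrow> (nat \<Rightarrow> complex) set" where
  "hw_generated n F R =
     module.span fscale {snd R k v | k v. k \<in> compact_set (O_cpt n) \<and> hw_vector n F R v}"

text \<open>The highest weight of the \<open>U(n)\<close>-type attached to \<open>(a\<^sub>1, \<dots>, a\<^bsub>[n/2]\<^esub>; \<epsilon>)\<close>.\<close>

definition O_to_U_weight :: "nat \<Rightarrow> int list \<Rightarrow> int \<Rightarrow> int list" where
  "O_to_U_weight n a \<epsilon> =
     (let x = card {i. i < length a \<and> a ! i > 0};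
          m = nat ((1 - \<epsilon>) div 2) * (n - 2 * x)
      in take x a @ replicate m 1 @ replicate (n - x - m) 0)"

definition O_type :: "nat \<Rightarrow> complex Matrix.mat crep \<Rightarrow> int list \<Rightarrow> int \<Rightarrow> bool" where
  "O_type n R a \<epsilon> \<longleftrightarrow>
     R \<in> compact_irreps (O_cpt n) \<and>
     length a = n div 2 \<and> sorted_wrt (\<ge>) a \<and> (\<forall>x\<in>set a. 0 \<le> x) \<and> \<epsilon> \<in> {1, -1} \<and>
     (\<exists>L F. U_type n L (O_to_U_weight n a \<epsilon>) \<and> orthogonal_flag n F \<and>
        equivalent_reps (compact_group (O_cpt n)) R (hw_generated n F L, snd L))"


section \<open>Parity\<close>

text \<open>\<open>factor_parity \<kappa> R e\<close> says that \<open>R\<close> is an irreducible \<open>\<kappa>\<close>-module of parity \<open>e\<close>.\<close>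

fun factor_parity :: "compact_factor \<Rightarrow> complex Matrix.mat crep \<Rightarrow> bit \<Rightarrow> bool" where
  "factor_parity (U_cpt n) R e \<longleftrightarrow> (\<exists>a. U_type n R a \<and> e = of_int (sum_list a))"
| "factor_parity (Sp_cpt n) R e \<longleftrightarrow> (\<exists>a. Sp_type n R a \<and> e = of_int (sum_list a))"
| "factor_parity (O_cpt n) R e \<longleftrightarrow>
     (\<exists>a \<epsilon>. O_type n R a \<epsilon> \<and> e = of_int (sum_list a + (1 - \<epsilon>) div 2 * int n))"

definition is_basis :: "(nat \<Rightarrow> complex) set \<Rightarrow> (nat \<Rightarrow> complex) set \<Rightarrow> bool" where
  "is_basis W B \<longleftrightarrow> \<not> module.dependent fscale B \<and> module.span fscale B = W"

text \<open>\<open>(W, \<rho>)\<close> is an external tensor product of the \<open>R x\<close>: there is an equivariant multilinear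
  map that sends tuples of basis vectors bijectively to a basis of \<open>W\<close>.\<close>

definition is_tensor_product ::
  "'i set \<Rightarrow> ('i \<Rightarrow> 'g monoid) \<Rightarrow> ('i \<Rightarrow> 'g crep) \<Rightarrow> ('i \<Rightarrow> 'g) crep \<Rightarrow> bool" where
  "is_tensor_product I H R = (\<lambda>(W, \<rho>). \<exists>\<tau>.
     \<tau> \<in> (\<Pi>\<^sub>E x\<in>I. fst (R x)) \<rightarrow> W \<and>
     (\<forall>w\<in>\<Pi>\<^sub>E x\<in>I. fst (R x). \<forall>x\<in>I.
        linear_between fscale (fst (R x)) fscale W (\<lambda>u. \<tau> (w(x := u)))) \<and>
     (\<forall>k\<in>carrier (product_group I H). \<forall>w\<in>\<Pi>\<^sub>E x\<in>I. fst (R x).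
        \<tau> (\<lambda>x\<in>I. snd (R x) (k x) (w x)) = \<rho> k (\<tau> w)) \<and>
     (\<exists>B. (\<forall>x\<in>I. is_basis (fst (R x)) (B x)) \<and>
          inj_on \<tau> (\<Pi>\<^sub>E x\<in>I. B x) \<and> is_basis W (\<tau> ` (\<Pi>\<^sub>E x\<in>I. B x))))"

text \<open>\<open>has_parity cs \<theta> \<sigma> e\<close> is the graph of the parity map: \<open>\<sigma>\<close>, regarded as a type of
  \<open>K\<^sub>1 \<times> \<dots> \<times> K\<^sub>r\<close> through the identification \<open>\<theta>\<close>, is a tensor product of types of the
  compact factors whose parities add up to \<open>e\<close>.\<close>

definition has_parity ::
  "classical list \<Rightarrow> ((nat \<Rightarrow> complex Matrix.mat) \<Rightarrow> real^'m^'m) \<Rightarrow> (real^'m^'m) crep set \<Rightarrow> bit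
    \<Rightarrow> bool" where
  "has_parity cs \<theta> \<sigma> e \<longleftrightarrow>
     (\<exists>(W, \<rho>)\<in>\<sigma>. \<exists>R d.
        is_tensor_product (K_index cs) (\<lambda>x. compact_group (K_factor cs x)) R
          (W, \<lambda>k. \<rho> (\<theta> (K_embed cs k))) \<and>
        (\<forall>x\<in>K_index cs. factor_parity (K_factor cs x) (R x) (d x)) \<and>
        e = (\<Sum>x\<in>K_index cs. d x))"

end

theory Submission
  imports Defs
begin

text \<open>The element \<open>- 1\<close> of each compact factor acts on a type of that factor by the sign of its
  parity, as one reads off on a weight vector of \<open>U(n)\<close> or \<open>Sp(n)\<close>; an \<open>O(n)\<close>-type inherits
  the sign from the \<open>U(n)\<close>-type that contains it.  Hence the tuple \<open>z = (- 1, \<dots>, - 1)\<close> acts on a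
  \<open>K\<close>-type \<open>\<sigma>\<close> by the sign of \<open>\<epsilon>(\<sigma>)\<close>.  Since \<open>z\<close> is mapped to \<open>- 1\<close> in every factor
  of \<open>G\<close>, it is central in \<open>G\<close>, so it commutes with \<open>K\<close> and \<open>Ad z\<close> is trivial on the Lie
  algebra.  The eigenspaces of \<open>z\<close> are therefore submodules, and \<open>z\<close> acts on an irreducible
  module by a single sign.\<close>

section \<open>Central scalars on irreducible modules\<close>

lemma vector_space_fscale: "vector_space fscale"
  by unfold_locales (auto simp: fscale_def algebra_simps fun_eq_iff)

text \<open>Schur's argument with the eigenvector supplied: the \<open>c\<close>-eigenspace of
  \<open>z\<close> in \<open>W\<close> contains \<open>v\<close> and is stable under
  \<open>H\<close> because \<open>z\<close> commutes with it, so it is all of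
  \<open>W\<close>.\<close>

lemma irreducible_rep_central_scalar:
  assumes "vector_space s" and rep: "group_rep H s W \<rho>" and irr: "irreducible_rep H s W \<rho>"
    and z: "z \<in> carrier H"
    and central: "\<And>g. g \<in> carrier H \<Longrightarrow> z \<otimes>\<^bsub>H\<^esub> g = g \<otimes>\<^bsub>H\<^esub> z"
    and v: "v \<in> W" "v \<noteq> 0" "\<rho> z v = s c v"
    and w: "w \<in> W"
  shows "\<rho> z w = s c w"
proof -
  interpret vector_space s by fact
  define U where "U = {u \<in> W. \<rho> z u = s c u}"
  have W: "subspace W" and lin: "\<And>g. g \<in> carrier H \<Longrightarrow> linear_between s W s W (\<rho> g)"
    and mult: "\<And>g h u. g \<in> carrier H \<Longrightarrow> h \<in> carrier H \<Longrightarrow> u \<in> W \<Longrightarrow>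
      \<rho> (g \<otimes>\<^bsub>H\<^esub> h) u = \<rho> g (\<rho> h u)"
    using rep by (auto simp: group_rep_def)
  have "\<rho> z 0 = 0"
    using lin[OF z] subspace_0[OF W] unfolding linear_between_def
    by (metis add_cancel_right_left)
  then have "subspace U"
    using W lin[OF z] unfolding U_def subspace_def linear_between_def
    by (auto simp: scale_right_distrib scale_left_commute)
  moreover have "\<rho> g u \<in> U" if g: "g \<in> carrier H" and u: "u \<in> U" for g u
  proof -
    have uW: "u \<in> W" "\<rho> z u = s c u" using u by (auto simp: U_def)
    have "\<rho> z (\<rho> g u) = \<rho> g (\<rho> z u)"
      using mult[OF z g uW(1)] mult[OF g z uW(1)] central[OF g] by simp
    also have "\<dots> = s c (\<rho> g u)"
      using uW lin[OF g] by (auto simp: linear_between_def)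
    finally show ?thesis
      using lin[OF g] uW by (auto simp: U_def linear_between_def)
  qed
  moreover have "U \<subseteq> W" "v \<in> U" using v by (auto simp: U_def)
  ultimately have "U = W" using irr v unfolding irreducible_rep_def by blast
  then show ?thesis using w by (auto simp: U_def)
qed

section \<open>A scalar action depends only on the K-type\<close>

text \<open>The intertwiner \<open>T\<close> is cancelled; it is injective only on \<open>W\<close>,
  so \<open>stable\<close> places both \<open>\<rho> z v\<close> and \<open>fscale c v\<close>
  there.\<close>

lemma equivalent_reps_scalar_left:
  assumes eq: "equivalent_reps H (W, \<rho>) (W', \<rho>')" and z: "z \<in> carrier H"
    and stable: "\<And>v. v \<in> W \<Longrightarrow> \<rho> z v \<in> W" "module.subspace fscale W"
    and sc: "\<And>v. v \<in> W' \<Longrightarrow> \<rho>' z v = fscale c v"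
    and v: "v \<in> W"
  shows "\<rho> z v = fscale c v"
proof -
  interpret vector_space fscale by (rule vector_space_fscale)
  obtain T where T: "linear_between fscale W fscale W' T" "bij_betw T W W'"
    "\<And>g v. g \<in> carrier H \<Longrightarrow> v \<in> W \<Longrightarrow> T (\<rho> g v) = \<rho>' g (T v)"
    using eq unfolding equivalent_reps_def by auto
  have "T v \<in> W'" using T(1) v by (auto simp: linear_between_def)
  then have "T (\<rho> z v) = T (fscale c v)"
    using T z v sc by (auto simp: linear_between_def)
  then show ?thesis
    using T(2) stable v subspace_scale by (meson bij_betw_imp_inj_on inj_onD)
qed

text \<open>This direction rests on surjectivity of \<open>T\<close>, so no inverse intertwiner has
  to be built.\<close>

lemma equivalent_reps_scalar_right:
  assumes eq: "equivalent_reps H (W, \<rho>) (W', \<rho>')" and z: "z \<in> carrier H"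
    and sc: "\<And>v. v \<in> W \<Longrightarrow> \<rho> z v = fscale c v"
    and v: "v \<in> W'"
  shows "\<rho>' z v = fscale c v"
proof -
  obtain T where T: "linear_between fscale W fscale W' T" "bij_betw T W W'"
    "\<And>g v. g \<in> carrier H \<Longrightarrow> v \<in> W \<Longrightarrow> T (\<rho> g v) = \<rho>' g (T v)"
    using eq unfolding equivalent_reps_def by auto
  obtain u where u: "u \<in> W" "v = T u" using T(2) v by (auto simp: bij_betw_def)
  then have "\<rho>' z v = T (fscale c u)" using T(3)[OF z] sc by metis
  then show ?thesis using T(1) u by (auto simp: linear_between_def)
qed

lemma K_type_scalar:
  assumes \<sigma>: "\<sigma> \<in> K_types H \<T>" and W: "(W, \<rho>) \<in> \<sigma>" "(W', \<rho>') \<in> \<sigma>"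
    and z: "z \<in> carrier H" and sc: "\<And>v. v \<in> W \<Longrightarrow> \<rho> z v = fscale c v"
    and v: "v \<in> W'"
  shows "\<rho>' z v = fscale c v"
proof -
  \<comment> \<open>A class of the quotient is the image of one representative, so both equivalences
    start at the same \<open>(W0, \<rho>0)\<close>. The scalar is pulled back along one and pushed
    forward along the other, without symmetry or transitivity.\<close>
  obtain W0 \<rho>0 where 0: "(W0, \<rho>0) \<in> irreps H \<T>"
    "equivalent_reps H (W0, \<rho>0) (W, \<rho>)" "equivalent_reps H (W0, \<rho>0) (W', \<rho>')"
    using \<sigma> W unfolding K_types_def quotient_def by fast
  have stable: "\<And>v. v \<in> W0 \<Longrightarrow> \<rho>0 z v \<in> W0" "module.subspace fscale W0"
    using 0(1) z by (auto simp: irreps_def fd_continuous_rep_def group_rep_def linear_between_def)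
  have "\<rho>0 z u = fscale c u" if "u \<in> W0" for u
    using equivalent_reps_scalar_left[OF 0(2) z stable sc that] .
  then show ?thesis using equivalent_reps_scalar_right[OF 0(3) z _ v] by blast
qed

section \<open>Parity as the value of the central character at \<open>- 1\<close>\<close>

definition bit_sign :: "bit \<Rightarrow> complex" where
  "bit_sign e = (if e = 0 then 1 else - 1)"

text \<open>Parities of factors add while scalars on a tensor product multiply; the homomorphism
  property links the two.\<close>

lemma bit_sign_add: "bit_sign (a + b) = bit_sign a * bit_sign b"
  by (cases a; cases b) (auto simp: bit_sign_def)

lemma bit_sign_sum: "finite A \<Longrightarrow> bit_sign (\<Sum>x\<in>A. d x) = (\<Prod>x\<in>A. bit_sign (d x))"
proof (induction A rule: finite_induct)
  case empty
  show ?case by (simp add: bit_sign_def)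
next
  case (insert x A)
  show ?case
    by (simp only: sum.insert[OF insert(1,2)] prod.insert[OF insert(1,2)] bit_sign_add insert.IH)
qed

text \<open>Injectivity finally recovers a parity from the scalar by which \<open>- 1\<close>
  acts.\<close>

lemma bit_sign_inject: "bit_sign a = bit_sign b \<longleftrightarrow> a = b"
  by (cases a; cases b) (auto simp: bit_sign_def)

lemma of_int_bit: "(of_int k :: bit) = (if even k then 0 else 1)"
  by (auto elim!: evenE oddE)

lemma minus_one_powi: "(- 1 :: complex) powi k = bit_sign (of_int k)"
  by (auto simp: of_int_bit bit_sign_def power_int_minus_left)

text \<open>The left side is the character of weight \<open>a\<close> at the torus point with all
  parameters \<open>- 1\<close>. Here the sum of the weight entries, which defines parity, becomes a
  scalar.\<close>

lemma prod_minus_one_powi: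
  "length a = n \<Longrightarrow> (\<Prod>i<n. (- 1 :: complex) powi (a ! i)) = bit_sign (of_int (sum_list a))"
  by (simp add: minus_one_powi bit_sign_sum[symmetric] sum_list_sum_nth atLeast0LessThan)

section \<open>The matrix \<open>- 1\<close> in the compact groups\<close>

lemma mat_diag_minus_one: "mat_diag n (\<lambda>i. - 1) = - (1\<^sub>m n :: complex Matrix.mat)"
  by (rule eq_matI) (auto simp: mat_diag_def)

lemma U_torus_minus_one: "U_torus n (\<lambda>i. - 1) = - 1\<^sub>m n"
  by (simp add: U_torus_def mat_diag_minus_one)

lemma Sp_torus_minus_one: "Sp_torus n (\<lambda>i. - 1) = - 1\<^sub>m (2 * n)"
  by (rule eq_matI) (auto simp: Sp_torus_def mat_diag_def)

lemma minus_one_mat_commute: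
  "A \<in> carrier_mat n n \<Longrightarrow> - 1\<^sub>m n * A = A * (- 1\<^sub>m n :: complex Matrix.mat)"
  by simp

lemma minus_one_mat_square: "- 1\<^sub>m n * - 1\<^sub>m n = (1\<^sub>m n :: complex Matrix.mat)"
  by (metis left_mult_one_mat one_carrier_mat uminus_carrier_iff_mat uminus_mult_left_mat
      uminus_mult_right_mat carrier_matD(1) carrier_matD(2) uminus_uminus_mat)

lemma mat_adjoint_minus_one: "mat_adjoint (- 1\<^sub>m n) = (- 1\<^sub>m n :: complex Matrix.mat)"
  by (rule eq_matI) (auto simp: mat_adjoint_def mat_of_rows_def conjugate_complex_def)

lemma transpose_minus_one: "transpose_mat (- 1\<^sub>m n) = (- 1\<^sub>m n :: complex Matrix.mat)"
  by (rule eq_matI) auto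

lemma cnj_mat_minus_one: "cnj_mat (- 1\<^sub>m n) = - 1\<^sub>m n"
  by (rule eq_matI) (auto simp: cnj_mat_def)

text \<open>Since adjoint and transpose fix \<open>- 1\<close>, this says that \<open>- 1\<close>
  preserves any bilinear or Hermitian form \<open>B\<close>.\<close>

lemma minus_one_conj:
  assumes "B \<in> carrier_mat n n"
  shows "- 1\<^sub>m n * B * - 1\<^sub>m n = (B :: complex Matrix.mat)"
  using assms by simp

lemma J_mat_carrier: "J_mat n \<in> carrier_mat (2 * n) (2 * n)"
  by (simp add: J_mat_def mult_2)

lemma I_mat_carrier: "I_mat p q \<in> carrier_mat (p + q) (p + q)"
  by (simp add: I_mat_def dsum_mat_def)

lemma compact_set_carrier: "compact_set \<kappa> \<subseteq> carrier_mat (compact_size \<kappa>) (compact_size \<kappa>)"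
  by (cases \<kappa>) auto

lemma minus_one_in_compact_set: "- 1\<^sub>m (compact_size \<kappa>) \<in> compact_set \<kappa>"
  by (cases \<kappa>) (auto simp: mat_adjoint_minus_one transpose_minus_one cnj_mat_minus_one
      minus_one_mat_square minus_one_conj[OF J_mat_carrier])

lemma compact_group_minus_one_central:
  assumes "g \<in> carrier (compact_group \<kappa>)"
  shows "- 1\<^sub>m (compact_size \<kappa>) \<otimes>\<^bsub>compact_group \<kappa>\<^esub> g
       = g \<otimes>\<^bsub>compact_group \<kappa>\<^esub> - 1\<^sub>m (compact_size \<kappa>)"
  using assms compact_set_carrier[of \<kappa>]
  by (auto simp: compact_group_def cmat_group_def intro!: minus_one_mat_commute)

lemma compact_irreps_scalar:
  assumes R: "(W, \<rho>) \<in> compact_irreps \<kappa>"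
    and "v \<in> W" "v \<noteq> 0" "\<rho> (- 1\<^sub>m (compact_size \<kappa>)) v = fscale c v" "w \<in> W"
  shows "\<rho> (- 1\<^sub>m (compact_size \<kappa>)) w = fscale c w"
proof (rule irreducible_rep_central_scalar[OF vector_space_fscale])
  show "group_rep (compact_group \<kappa>) fscale W \<rho>" "irreducible_rep (compact_group \<kappa>) fscale W \<rho>"
    using R by (auto simp: compact_irreps_def irreps_def fd_continuous_rep_def)
  show "- 1\<^sub>m (compact_size \<kappa>) \<in> carrier (compact_group \<kappa>)"
    using minus_one_in_compact_set by (simp add: compact_group_def cmat_group_def)
qed (use assms compact_group_minus_one_central in auto)

section \<open>Types of U(n) and Sp(n)\<close>

lemma U_type_scalar:
  assumes "U_type n R a" "w \<in> fst R"
  shows "snd R (- 1\<^sub>m n) w = fscale (bit_sign (of_int (sum_list a))) w"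
proof -
  obtain W \<rho> where R: "R = (W, \<rho>)" by (cases R)
  obtain v where v: "length a = n" "v \<in> W" "v \<noteq> 0"
    "\<forall>t. (\<forall>i<n. norm (t i) = 1) \<longrightarrow>
        \<rho> (U_torus n t) v = fscale (\<Prod>i<n. t i powi (a ! i)) v"
    using assms(1) by (auto simp: R U_type_def highest_weight_def has_weight_def)
  have "\<rho> (- 1\<^sub>m n) v = fscale (bit_sign (of_int (sum_list a))) v"
    \<comment> \<open>Setting every torus parameter to \<open>- 1\<close>, of norm 1, turns the
      torus element into the central matrix.\<close>
    using v(4)[rule_format, of "\<lambda>i. - 1"] v(1) by (simp add: U_torus_minus_one prod_minus_one_powi)
  then show ?thesis
    using compact_irreps_scalar[of W \<rho> "U_cpt n" v] v assms by (simp add: R U_type_def)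
qed

lemma Sp_type_scalar:
  assumes "Sp_type n R a" "w \<in> fst R"
  shows "snd R (- 1\<^sub>m (2 * n)) w = fscale (bit_sign (of_int (sum_list a))) w"
proof -
  obtain W \<rho> where R: "R = (W, \<rho>)" by (cases R)
  obtain v where v: "length a = n" "v \<in> W" "v \<noteq> 0"
    "\<forall>t. (\<forall>i<n. norm (t i) = 1) \<longrightarrow>
        \<rho> (Sp_torus n t) v = fscale (\<Prod>i<n. t i powi (a ! i)) v"
    using assms(1) by (auto simp: R Sp_type_def highest_weight_def has_weight_def)
  have "\<rho> (- 1\<^sub>m (2 * n)) v = fscale (bit_sign (of_int (sum_list a))) v"
    using v(4)[rule_format, of "\<lambda>i. - 1"] v(1) by (simp add: Sp_torus_minus_one prod_minus_one_powi)
  then show ?thesis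
    using compact_irreps_scalar[of W \<rho> "Sp_cpt n" v] v assms by (simp add: R Sp_type_def)
qed

section \<open>Types of O(n) through Weyl's parametrization\<close>

text \<open>In a nonincreasing list the positive entries form an initial segment, so only zeros are
  cut off.\<close>

lemma sum_list_take_positive:
  fixes a :: "int list"
  assumes "sorted_wrt (\<ge>) a" "\<forall>x\<in>set a. 0 \<le> x"
  shows "sum_list (take (card {i. i < length a \<and> a ! i > 0}) a) = sum_list a"
  using assms
proof (induction a)
  case (Cons y a)
  let ?A = "{i. i < length a \<and> a ! i > 0}"
  show ?case
  proof (cases "y > 0")
    case True
    have "{i. i < length (y # a) \<and> (y # a) ! i > 0} = insert 0 (Suc ` ?A)"
      using True by (auto simp: image_iff nth_Cons split: nat.splits)
        (metis (full_types) Suc_less_eq not0_implies_Suc)+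
    then have "card {i. i < length (y # a) \<and> (y # a) ! i > 0} = Suc (card ?A)"
      by (simp add: card_image)
    then show ?thesis using Cons by simp
  next
    case False
    \<comment> \<open>A head that is not positive is 0 and bounds the later nonnegative entries, so
      both sums vanish.\<close>
    then have zero: "\<forall>x\<in>set (y # a). x = 0" using Cons.prems by force
    have "sum_list xs = 0" if "\<forall>x\<in>set xs. x = 0" for xs :: "int list"
      using that by (induction xs) auto
    then show ?thesis by (metis zero in_set_takeD)
  qed
qed simp

text \<open>For \<open>\<epsilon> = - 1\<close> Weyl's weight appends \<open>n - 2 * x\<close> ones,
  where \<open>x\<close> counts the positive entries; this differs from the \<open>n\<close> in the
  parity by an even number.\<close>

lemma O_to_U_weight_parity:
  assumes "length a = n div 2" "sorted_wrt (\<ge>) a" "\<forall>x\<in>set a. 0 \<le> x" "\<epsilon> \<in> {1, - 1}"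
  shows "(of_int (sum_list (O_to_U_weight n a \<epsilon>)) :: bit)
       = of_int (sum_list a + (1 - \<epsilon>) div 2 * int n)"
proof -
  define x where "x = card {i. i < length a \<and> a ! i > 0}"
  have "x \<le> card {..<length a}" unfolding x_def by (rule card_mono) auto
  \<comment> \<open>The natural subtraction does not truncate, because \<open>x\<close> is at most
    \<open>n div 2\<close>.\<close>
  then have "int (n - 2 * x) = int n - 2 * int x" using assms(1) by simp
  then have "sum_list (O_to_U_weight n a \<epsilon>)
      = sum_list a + (1 - \<epsilon>) div 2 * int n - 2 * ((1 - \<epsilon>) div 2 * int x)"
    using sum_list_take_positive[OF assms(2,3)] assms(4)
    by (auto simp: O_to_U_weight_def Let_def x_def[symmetric] sum_list_replicate)
  then show ?thesis by (simp add: of_int_bit)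
qed

text \<open>The same matrix \<open>- 1\<close> lies in O(n) and U(n). It acts by a scalar on the
  whole U(n)-module \<open>L\<close>, hence on the O(n)-submodule generated by highest weight
  vectors, to which \<open>R\<close> is equivalent.\<close>

lemma O_type_scalar:
  assumes "O_type n R a \<epsilon>" "w \<in> fst R"
  shows "snd R (- 1\<^sub>m n) w
       = fscale (bit_sign (of_int (sum_list a + (1 - \<epsilon>) div 2 * int n))) w"
proof -
  interpret vector_space fscale by (rule vector_space_fscale)
  obtain L F where L: "U_type n L (O_to_U_weight n a \<epsilon>)"
    and eq: "equivalent_reps (compact_group (O_cpt n)) R (hw_generated n F L, snd L)"
    using assms(1) by (auto simp: O_type_def)
  have rep: "group_rep (compact_group (U_cpt n)) fscale (fst L) (snd L)"
    using L by (auto simp: U_type_def compact_irreps_def irreps_def fd_continuous_rep_def)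
  \<comment> \<open>The generators stay in \<open>L\<close> because O(n) is contained in
    U(n).\<close>
  have "hw_generated n F L \<subseteq> fst L"
    unfolding hw_generated_def
  proof (rule span_minimal)
    show "subspace (fst L)" using rep by (simp add: group_rep_def)
    show "{snd L k v | k v. k \<in> compact_set (O_cpt n) \<and> hw_vector n F L v} \<subseteq> fst L"
      using rep
      by (auto simp: group_rep_def linear_between_def hw_vector_def compact_group_def cmat_group_def)
  qed
  then have sc: "snd L (- 1\<^sub>m n) u
      = fscale (bit_sign (of_int (sum_list a + (1 - \<epsilon>) div 2 * int n))) u"
    if "u \<in> hw_generated n F L" for u
    using that U_type_scalar[OF L, of u] O_to_U_weight_parity[of a n \<epsilon>] assms(1)
    unfolding O_type_def by (metis subsetD)
  obtain W \<rho> where R: "R = (W, \<rho>)" by (cases R)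
  have z: "- 1\<^sub>m n \<in> carrier (compact_group (O_cpt n))"
    using minus_one_in_compact_set[of "O_cpt n"] by (simp add: compact_group_def cmat_group_def)
  have "group_rep (compact_group (O_cpt n)) fscale W \<rho>"
    using assms(1) by (auto simp: R O_type_def compact_irreps_def irreps_def fd_continuous_rep_def)
  then have stable: "\<And>v. v \<in> W \<Longrightarrow> \<rho> (- 1\<^sub>m n) v \<in> W" "subspace W"
    using z by (auto simp: group_rep_def linear_between_def)
  show ?thesis
    using equivalent_reps_scalar_left[OF eq[unfolded R] z stable sc] assms(2) by (simp add: R)
qed

lemma factor_parity_scalar:
  assumes "factor_parity \<kappa> R e" "w \<in> fst R"
  shows "snd R (- 1\<^sub>m (compact_size \<kappa>)) w = fscale (bit_sign e) w"
proof (cases \<kappa>)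
  case (U_cpt n)
  show ?thesis
    using assms unfolding U_cpt factor_parity.simps compact_size.simps using U_type_scalar by blast
next
  case (Sp_cpt n)
  show ?thesis
    using assms unfolding Sp_cpt factor_parity.simps compact_size.simps using Sp_type_scalar by blast
next
  case (O_cpt n)
  show ?thesis
    using assms unfolding O_cpt factor_parity.simps compact_size.simps using O_type_scalar by blast
qed

section \<open>Tensor products over the compact factors\<close>

text \<open>The index set \<open>I\<close> of the tuples stays fixed while the set \<open>J\<close>
  of scaled coordinates grows, so that induction pulls out one scalar at a time.\<close>

lemma multilinear_scale:
  assumes "finite J" "J \<subseteq> I"
    and lin: "\<And>w x. w \<in> (\<Pi>\<^sub>E x\<in>I. A x) \<Longrightarrow> x \<in> I \<Longrightarrow>
        linear_between fscale (A x) fscale W (\<lambda>u. \<tau> (w(x := u)))"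
    and closed: "\<And>x c u. x \<in> I \<Longrightarrow> u \<in> A x \<Longrightarrow> fscale c u \<in> A x"
    and w: "w \<in> (\<Pi>\<^sub>E x\<in>I. A x)"
  shows "\<tau> (\<lambda>x\<in>I. if x \<in> J then fscale (c x) (w x) else w x) = fscale (\<Prod>x\<in>J. c x) (\<tau> w)"
  using assms(1,2)
proof (induction J rule: finite_induct)
  case empty
  have "(\<lambda>x\<in>I. w x) = w" using w by (auto simp: PiE_def extensional_restrict)
  then show ?case by (simp add: fscale_def)
next
  case (insert y J)
  let ?w = "\<lambda>x\<in>I. if x \<in> J then fscale (c x) (w x) else w x"
  have y: "y \<in> I" and wy: "w y \<in> A y" using insert w by auto
  have "?w \<in> (\<Pi>\<^sub>E x\<in>I. A x)" using w closed by (auto simp: PiE_iff)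
  from lin[OF this y] have "\<tau> (?w(y := fscale (c y) (w y))) = fscale (c y) (\<tau> (?w(y := w y)))"
    using wy by (simp add: linear_between_def)
  \<comment> \<open>As \<open>y\<close> is not in \<open>J\<close>, its coordinate has not been
    scaled yet.\<close>
  also have "?w(y := w y) = ?w" using insert y by (auto simp: fun_eq_iff)
  also have "?w(y := fscale (c y) (w y))
      = (\<lambda>x\<in>I. if x \<in> insert y J then fscale (c x) (w x) else w x)"
    using y by (auto simp: fun_eq_iff)
  finally show ?case
    using insert by (auto simp: fscale_def mult.assoc)
qed

text \<open>Restriction to the index set makes the tuple extensional, as the carrier of a product
  group demands.\<close>

definition minus_one_tuple :: "classical list \<Rightarrow> nat \<times> nat \<Rightarrow> complex Matrix.mat" where
  "minus_one_tuple cs = (\<lambda>x\<in>K_index cs. - 1\<^sub>m (compact_size (K_factor cs x)))"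

lemma finite_K_index: "finite (K_index cs)"
proof -
  have "K_index cs = (SIGMA i:{..<length cs}. {..<length (compact_factors (cs ! i))})"
    by (auto simp: K_index_def)
  then show ?thesis by simp
qed

lemma minus_one_tuple_carrier: "minus_one_tuple cs \<in> carrier (K_product cs)"
  using minus_one_in_compact_set
  by (auto simp: minus_one_tuple_def K_product_def compact_group_def cmat_group_def)

text \<open>A single nonzero pure tensor suffices: each component contributes its sign, and
  multilinearity collects their product.\<close>

lemma tensor_product_eigenvector:
  assumes W: "W \<noteq> {0}" "W \<noteq> {}"
    and tp: "is_tensor_product (K_index cs) (\<lambda>x. compact_group (K_factor cs x)) R (W, \<rho>)"
    and par: "\<forall>x\<in>K_index cs. factor_parity (K_factor cs x) (R x) (d x)"
  shows "\<exists>v\<in>W. v \<noteq> 0 \<and>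
    \<rho> (minus_one_tuple cs) v = fscale (bit_sign (\<Sum>x\<in>K_index cs. d x)) v"
proof -
  interpret vector_space fscale by (rule vector_space_fscale)
  let ?I = "K_index cs"
  obtain \<tau> B where *: "\<forall>w\<in>\<Pi>\<^sub>E x\<in>?I. fst (R x). \<forall>x\<in>?I.
        linear_between fscale (fst (R x)) fscale W (\<lambda>u. \<tau> (w(x := u)))"
      "\<forall>k\<in>carrier (K_product cs). \<forall>w\<in>\<Pi>\<^sub>E x\<in>?I. fst (R x).
        \<tau> (\<lambda>x\<in>?I. snd (R x) (k x) (w x)) = \<rho> k (\<tau> w)"
      "\<forall>x\<in>?I. is_basis (fst (R x)) (B x)"
    and BW: "is_basis W (\<tau> ` (\<Pi>\<^sub>E x\<in>?I. B x))"
    using tp unfolding is_tensor_product_def K_product_def prod.case by blast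
  note lin = *(1)[rule_format] and eqv = *(2)[rule_format] and B = *(3)[rule_format]
  \<comment> \<open>If all pure tensors of basis vectors vanished, they could span only the zero
    space.\<close>
  have "span {0} = {0::nat \<Rightarrow> complex}" by simp
  then have "\<not> \<tau> ` (\<Pi>\<^sub>E x\<in>?I. B x) \<subseteq> {0}"
    using W BW span_mono[of "\<tau> ` (\<Pi>\<^sub>E x\<in>?I. B x)" "{0}"] by (auto simp: is_basis_def)
  then obtain w where w: "w \<in> (\<Pi>\<^sub>E x\<in>?I. B x)" "\<tau> w \<noteq> 0" by auto
  have \<tau>W: "\<tau> w \<in> W" using w(1) BW span_base by (auto simp: is_basis_def)
  have wR: "w \<in> (\<Pi>\<^sub>E x\<in>?I. fst (R x))"
  proof -
    have "B x \<subseteq> fst (R x)" if "x \<in> ?I" for x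
      using B[OF that] span_superset unfolding is_basis_def by blast
    then show ?thesis using w(1) PiE_mono[of ?I B "\<lambda>x. fst (R x)"] by blast
  qed
  have "\<rho> (minus_one_tuple cs) (\<tau> w)
      = \<tau> (\<lambda>x\<in>?I. snd (R x) (minus_one_tuple cs x) (w x))"
    using eqv[OF minus_one_tuple_carrier wR] by simp
  \<comment> \<open>The vacuous conditional matches \<open>multilinear_scale\<close> with
    \<open>J\<close> equal to the full index set.\<close>
  also have "(\<lambda>x\<in>?I. snd (R x) (minus_one_tuple cs x) (w x))
      = (\<lambda>x\<in>?I. if x \<in> ?I then fscale (bit_sign (d x)) (w x) else w x)"
    using par factor_parity_scalar wR
    by (intro restrict_ext) (auto simp: minus_one_tuple_def PiE_iff)
  also have "\<tau> \<dots> = fscale (\<Prod>x\<in>?I. bit_sign (d x)) (\<tau> w)"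
  proof (rule multilinear_scale[OF finite_K_index subset_refl lin _ wR])
    show "fscale c u \<in> fst (R x)" if "x \<in> ?I" "u \<in> fst (R x)" for x c u
      using B[OF that(1)] that(2) span_scale unfolding is_basis_def by metis
  qed
  finally have "\<rho> (minus_one_tuple cs) (\<tau> w) = fscale (bit_sign (\<Sum>x\<in>?I. d x)) (\<tau> w)"
    by (simp add: bit_sign_sum finite_K_index)
  then show ?thesis using w(2) \<tau>W by blast
qed

section \<open>The central element \<open>- 1\<close> of a product of classical groups\<close>

lemma minus_one_GLC: "- 1\<^sub>m n \<in> GLC n"
proof -
  have "inverts_mat (- 1\<^sub>m n) (- 1\<^sub>m n :: complex Matrix.mat)"
    by (simp add: inverts_mat_def minus_one_mat_square)
  then show ?thesis unfolding GLC_def invertible_mat_def by auto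
qed

lemma minus_one_GLR: "- 1\<^sub>m n \<in> GLR n"
  by (simp add: GLR_def minus_one_GLC cnj_mat_minus_one)

lemma minus_one_GLH: "- 1\<^sub>m (2 * n) \<in> GLH n"
  using minus_one_mat_commute[OF J_mat_carrier[of n]]
  by (simp add: GLH_def minus_one_GLC cnj_mat_minus_one)

lemma minus_one_in_classical_set: "- 1\<^sub>m (classical_size c) \<in> classical_set c"
proof (cases c)
  case (Sp_sig p q)
  have "dsum_mat (I_mat p q) (I_mat p q) \<in> carrier_mat (2 * (p + q)) (2 * (p + q))"
    using I_mat_carrier[of p q] by (auto simp: dsum_mat_def mult_2)
  from minus_one_conj[OF this] show ?thesis
    using Sp_sig minus_one_GLH[of "p + q"] by (simp add: mat_adjoint_minus_one)
qed (use minus_one_GLH minus_one_GLC minus_one_GLR in \<open>auto simp: mat_adjoint_minus_one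
      transpose_minus_one minus_one_mat_square minus_one_conj[OF J_mat_carrier]
      minus_one_conj[OF I_mat_carrier]\<close>)

lemma classical_set_carrier:
  "classical_set c \<subseteq> carrier_mat (classical_size c) (classical_size c)"
  by (cases c) (auto simp: GLC_def GLR_def GLH_def)

lemma dsum_mat_minus_one: "dsum_mat (- 1\<^sub>m p) (- 1\<^sub>m q) = - 1\<^sub>m (p + q)"
  by (rule eq_matI) (auto simp: dsum_mat_def)

lemma real_form_minus_one: "real_form (- 1\<^sub>m n) = - 1\<^sub>m (2 * n)"
  by (rule eq_matI) (auto simp: real_form_def)

text \<open>Both arguments have zero off-diagonal blocks, so only the two diagonal blocks contribute
  to the rearranged sum.\<close>

lemma quat_dsum_minus_one: "quat_dsum p q (- 1\<^sub>m (2 * p)) (- 1\<^sub>m (2 * q)) = - 1\<^sub>m (2 * (p + q))"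
proof -
  have split: "split_block (- 1\<^sub>m (2 * n)) n n = (- 1\<^sub>m n, 0\<^sub>m n n, 0\<^sub>m n n, - (1\<^sub>m n :: complex Matrix.mat))"
    for n
    by (auto simp: split_block_def Let_def intro!: eq_matI)
  have zero: "dsum_mat (0\<^sub>m p p) (0\<^sub>m q q) = 0\<^sub>m (p + q) (p + q)"
    by (rule eq_matI) (auto simp: dsum_mat_def)
  show ?thesis
    by (rule eq_matI) (auto simp: quat_dsum_def split zero dsum_mat_minus_one)
qed

lemma compact_embed_minus_one:
  assumes "\<And>j. j < length (compact_factors c) \<Longrightarrow>
    k j = - 1\<^sub>m (compact_size (compact_factors c ! j))"
  shows "compact_embed c k = - 1\<^sub>m (classical_size c)"
  \<comment> \<open>No classical group has more than two compact factors, so positions 0 and 1 cover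
    all cases.\<close>
  using assms[of 0] assms[of 1]
  by (cases c) (simp_all add: dsum_mat_minus_one real_form_minus_one quat_dsum_minus_one)

text \<open>The tuple becomes a scalar matrix in each factor of \<open>G\<close>, so it is central
  in \<open>G\<close> and not merely in \<open>K\<close>.\<close>

lemma K_embed_minus_one:
  "K_embed cs (minus_one_tuple cs) = (\<lambda>i\<in>{..<length cs}. - 1\<^sub>m (classical_size (cs ! i)))"
  unfolding K_embed_def
  by (intro restrict_ext compact_embed_minus_one)
     (auto simp: minus_one_tuple_def K_index_def K_factor_def)

lemma K_embed_minus_one_carrier: "K_embed cs (minus_one_tuple cs) \<in> carrier (G_product cs)"
  using minus_one_in_classical_set
  by (auto simp: K_embed_minus_one G_product_def classical_group_def cmat_group_def)

lemma one_in_classical_set: "1\<^sub>m (classical_size c) \<in> classical_set c"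
proof -
  have GL: "1\<^sub>m n \<in> GLC n" "1\<^sub>m n \<in> GLR n" "1\<^sub>m (2 * n) \<in> GLH n" for n
  proof -
    show "1\<^sub>m n \<in> GLC n" for n
      by (auto simp: GLC_def invertible_mat_def inverts_mat_def intro!: exI[of _ "1\<^sub>m n"])
    moreover have "cnj_mat (1\<^sub>m n) = 1\<^sub>m n" for n
      by (rule eq_matI) (auto simp: cnj_mat_def)
    ultimately show "1\<^sub>m n \<in> GLR n" "1\<^sub>m (2 * n) \<in> GLH n"
      using J_mat_carrier[of n] by (auto simp: GLR_def GLH_def)
  qed
  have adj: "mat_adjoint (1\<^sub>m n) = (1\<^sub>m n :: complex Matrix.mat)" for n
    by (rule eq_matI) (auto simp: mat_adjoint_def mat_of_rows_def conjugate_complex_def)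
  have D: "dsum_mat (I_mat p q) (I_mat p q) \<in> carrier_mat (2 * (p + q)) (2 * (p + q))" for p q
    using I_mat_carrier[of p q] by (auto simp: dsum_mat_def mult_2)
  have conj: "1\<^sub>m n * B * 1\<^sub>m n = B" if "B \<in> carrier_mat n n" for B :: "complex Matrix.mat" and n
    using that by simp
  show ?thesis
    using GL by (cases c) (auto simp: adj conj[OF D] conj[OF J_mat_carrier] conj[OF I_mat_carrier]
      simp del: distrib_left_numeral)
qed

lemma G_product_one_carrier: "\<one>\<^bsub>G_product cs\<^esub> \<in> carrier (G_product cs)"
  using one_in_classical_set by (auto simp: G_product_def classical_group_def cmat_group_def)

lemma K_embed_minus_one_central:
  assumes "g \<in> carrier (G_product cs)"
  shows "K_embed cs (minus_one_tuple cs) \<otimes>\<^bsub>G_product cs\<^esub> g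
       = g \<otimes>\<^bsub>G_product cs\<^esub> K_embed cs (minus_one_tuple cs)"
proof -
  have "g i \<in> carrier_mat (classical_size (cs ! i)) (classical_size (cs ! i))"
    if "i < length cs" for i
    using assms that classical_set_carrier[of "cs ! i"]
    by (auto simp: G_product_def classical_group_def cmat_group_def PiE_iff)
  then show ?thesis
    by (auto simp: G_product_def K_embed_minus_one classical_group_def cmat_group_def
        intro!: restrict_ext minus_one_mat_commute)
qed

text \<open>This yields invertibility of the image of the tuple in \<open>G\<close>, which
  \<open>Ad\<close> relies on.\<close>

lemma K_embed_minus_one_square:
  "K_embed cs (minus_one_tuple cs) \<otimes>\<^bsub>G_product cs\<^esub> K_embed cs (minus_one_tuple cs)
     = \<one>\<^bsub>G_product cs\<^esub>"
  by (auto simp: G_product_def K_embed_minus_one classical_group_def cmat_group_def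
      minus_one_mat_square intro!: restrict_ext)

section \<open>Triviality of the adjoint action of a central element\<close>

text \<open>The sum of all absolute entries dominates every row sum. This crude bound makes the
  exponential series converge entrywise.\<close>

lemma matrix_power_entry_bound:
  fixes X :: "real^'m^'m"
  shows "\<bar>((**) X ^^ k) (mat 1) $ i $ j\<bar> \<le> (\<Sum>i\<in>UNIV. \<Sum>l\<in>UNIV. \<bar>X $ i $ l\<bar>) ^ k"
proof (induction k arbitrary: i j)
  case 0
  show ?case by (simp add: Finite_Cartesian_Product.mat_def)
next
  case (Suc k)
  let ?P = "((**) X ^^ k) (mat 1)" and ?M = "\<Sum>i\<in>UNIV. \<Sum>l\<in>UNIV. \<bar>X $ i $ l\<bar>"
  have "\<bar>(X ** ?P) $ i $ j\<bar> \<le> (\<Sum>l\<in>UNIV. \<bar>X $ i $ l\<bar> * \<bar>?P $ l $ j\<bar>)"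
    by (simp add: matrix_matrix_mult_def abs_mult[symmetric])
  also have "\<dots> \<le> (\<Sum>l\<in>UNIV. \<bar>X $ i $ l\<bar> * ?M ^ k)"
    by (intro sum_mono mult_left_mono Suc) auto
  also have "\<dots> = (\<Sum>l\<in>UNIV. \<bar>X $ i $ l\<bar>) * ?M ^ k" by (simp add: sum_distrib_right)
  also have "\<dots> \<le> ?M * ?M ^ k"
    by (intro mult_right_mono zero_le_power sum_nonneg
        member_le_sum[where f = "\<lambda>i. \<Sum>l\<in>UNIV. \<bar>X $ i $ l\<bar>"]) auto
  finally show ?case by simp
qed

text \<open>Each entry is an everywhere convergent power series in \<open>t\<close>, by comparison
  with an exponential series, and is differentiated termwise.\<close>

lemma mexp_has_derivative_at_0:
  fixes X :: "real^'m^'m"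
  shows "((\<lambda>t. mexp (t *\<^sub>R X) $ i $ j) has_real_derivative X $ i $ j) (at 0)"
proof -
  let ?P = "\<lambda>k. ((**) X ^^ k) (mat 1)" and ?M = "\<Sum>i\<in>UNIV. \<Sum>l\<in>UNIV. \<bar>X $ i $ l\<bar>"
  define c where "c k = ?P k $ i $ j / fact k" for k
  have "((**) (t *\<^sub>R X) ^^ k) (mat 1) = t ^ k *\<^sub>R ?P k" for t k
    by (induction k) (simp_all add: matrix_scalar_ac scalar_matrix_assoc[symmetric])
  then have mexp: "mexp (t *\<^sub>R X) $ i $ j = (\<Sum>k. c k * t ^ k)" for t
    by (simp add: mexp_def c_def mult.commute)
  have summable: "summable (\<lambda>k. c k * t ^ k)" for t
  proof (rule summable_comparison_test')
    show "summable (\<lambda>k. (?M * \<bar>t\<bar>) ^ k / fact k)"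
      using summable_exp_generic[of "?M * \<bar>t\<bar>"] by (simp add: divide_inverse mult.commute)
    show "norm (c k * t ^ k) \<le> (?M * \<bar>t\<bar>) ^ k / fact k" for k
      using matrix_power_entry_bound[of k X i j]
      by (auto simp: c_def abs_mult power_abs power_mult_distrib divide_simps intro!: mult_right_mono)
  qed
  have "((\<lambda>t. \<Sum>k. c k * t ^ k) has_real_derivative (\<Sum>k. diffs c k * 0 ^ k)) (at 0)"
    by (rule termdiffs_strong_converges_everywhere[OF summable])
  \<comment> \<open>At 0 only the constant term of the differentiated series survives, which is
    \<open>c 1\<close>.\<close>
  moreover have "(\<Sum>k. diffs c k * 0 ^ k) = X $ i $ j"
    by (simp only: powser_zero) (simp add: diffs_def c_def)
  ultimately show ?thesis by (simp add: mexp)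
qed

text \<open>Differentiate \<open>z ** mexp (t *\<^sub>R X) = mexp (t *\<^sub>R X) ** z\<close>
  entrywise at \<open>t = 0\<close> and use uniqueness of derivatives.\<close>

lemma lie_algebra_commute:
  fixes X z :: "real^'m^'m"
  assumes X: "X \<in> lie_algebra G" and central: "\<And>g. g \<in> G \<Longrightarrow> z ** g = g ** z"
  shows "z ** X = X ** z"
proof -
  have "(z ** X) $ i $ j = (X ** z) $ i $ j" for i j
  proof -
    let ?D = "\<lambda>t. (\<Sum>l\<in>UNIV. z $ i $ l * mexp (t *\<^sub>R X) $ l $ j)"
    have "(?D has_real_derivative (\<Sum>l\<in>UNIV. z $ i $ l * X $ l $ j)) (at 0)"
      by (intro DERIV_sum DERIV_cmult mexp_has_derivative_at_0)
    moreover have "((\<lambda>t. \<Sum>l\<in>UNIV. mexp (t *\<^sub>R X) $ i $ l * z $ l $ j)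
        has_real_derivative (\<Sum>l\<in>UNIV. X $ i $ l * z $ l $ j)) (at 0)"
      by (intro DERIV_sum DERIV_cmult_right mexp_has_derivative_at_0)
    moreover have "?D = (\<lambda>t. \<Sum>l\<in>UNIV. mexp (t *\<^sub>R X) $ i $ l * z $ l $ j)"
    proof
      fix t
      have "mexp (t *\<^sub>R X) \<in> G" using X by (simp add: lie_algebra_def)
      from central[OF this]
      have "(z ** mexp (t *\<^sub>R X)) $ i $ j = (mexp (t *\<^sub>R X) ** z) $ i $ j" by simp
      then show "?D t = (\<Sum>l\<in>UNIV. mexp (t *\<^sub>R X) $ i $ l * z $ l $ j)"
        by (simp add: matrix_matrix_mult_def)
    qed
    ultimately have "(\<Sum>l\<in>UNIV. z $ i $ l * X $ l $ j) = (\<Sum>l\<in>UNIV. X $ i $ l * z $ l $ j)"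
      by (simp only: DERIV_unique)
    then show ?thesis by (simp add: matrix_matrix_mult_def)
  qed
  then show ?thesis by (simp add: Finite_Cartesian_Product.vec_eq_iff)
qed

lemma of_real_mat_mult: "of_real_mat (A ** B) = of_real_mat A ** of_real_mat B"
  by (simp add: of_real_mat_def matrix_matrix_mult_def Finite_Cartesian_Product.vec_eq_iff)

lemma of_real_mat_one: "of_real_mat (mat 1) = mat 1"
  by (simp add: of_real_mat_def Finite_Cartesian_Product.mat_def Finite_Cartesian_Product.vec_eq_iff)

text \<open>The real and imaginary parts of \<open>Z\<close> lie in the real Lie algebra and commute
  with \<open>z\<close>, hence so does \<open>Z\<close>, and the conjugation cancels.\<close>

lemma Ad_central:
  fixes z :: "real^'m^'m"
  assumes Z: "Z \<in> cplx_lie_algebra G" and central: "\<And>g. g \<in> G \<Longrightarrow> z ** g = g ** z"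
    and inv: "invertible z"
  shows "Ad z Z = Z"
proof -
  have "z ** Re_mat Z = Re_mat Z ** z" "z ** Im_mat Z = Im_mat Z ** z"
    using Z lie_algebra_commute[OF _ central] by (auto simp: cplx_lie_algebra_def)
  then have "of_real_mat z ** Z = Z ** of_real_mat z"
    by (simp add: complex_eq_iff of_real_mat_def matrix_matrix_mult_def Re_mat_def Im_mat_def
        Finite_Cartesian_Product.vec_eq_iff)
  then have "Ad z Z = Z ** of_real_mat (z ** matrix_inv z)"
    by (simp add: Ad_def of_real_mat_mult matrix_mul_assoc)
  moreover have "z ** matrix_inv z = mat 1"
    using someI_ex[OF inv[unfolded invertible_def]] by (simp add: matrix_inv_def)
  ultimately show ?thesis by (simp add: of_real_mat_one)
qed

section \<open>Central elements acting on irreducible modules\<close>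

text \<open>The eigenspace argument again: equivariance of \<open>\<alpha>\<close> with
  \<open>Ad z Z = Z\<close> gives stability under the Lie algebra, and centrality gives stability
  under \<open>K\<close>.\<close>

lemma irreducible_gK_module_central_scalar:
  assumes irr: "irreducible_gK_module G K s \<alpha> \<pi>" and z: "z \<in> K" "invertible z"
    and KG: "K \<subseteq> G" and central: "\<And>g. g \<in> G \<Longrightarrow> z ** g = g ** z"
    and v: "v \<noteq> 0" "\<pi> z v = s c v"
  shows "\<pi> z w = s c w"
proof -
  have gK: "gK_module G K s \<alpha> \<pi>" using irr by (simp add: irreducible_gK_module_def)
  interpret vector_space s using gK by (simp add: gK_module_def)
  define U where "U = {u. \<pi> z u = s c u}"
  have rep: "group_rep (rmat_group K) s UNIV \<pi>" using gK by (simp add: gK_module_def)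
  have lin: "\<And>k. k \<in> K \<Longrightarrow> linear_between s UNIV s UNIV (\<pi> k)"
    and mult: "\<And>g h u. g \<in> K \<Longrightarrow> h \<in> K \<Longrightarrow> \<pi> (g ** h) u = \<pi> g (\<pi> h u)"
    using rep by (auto simp: group_rep_def rmat_group_def)
  have "\<pi> z 0 = 0"
    using lin[OF z(1)] unfolding linear_between_def by (metis UNIV_I add_cancel_right_left)
  then have "subspace U"
    using lin[OF z(1)] unfolding U_def subspace_def linear_between_def
    by (auto simp: scale_right_distrib scale_left_commute)
  moreover have "\<alpha> Z u \<in> U" if Z: "Z \<in> cplx_lie_algebra G" and u: "u \<in> U" for Z u
  proof -
    have "\<pi> z (\<alpha> Z u) = \<alpha> (Ad z Z) (\<pi> z u)"
      using gK z(1) Z by (auto simp: gK_module_def)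
    also have "\<dots> = s c (\<alpha> Z u)"
      using u gK Z Ad_central[OF Z central z(2)] by (simp add: U_def gK_module_def linear_between_def)
    finally show ?thesis by (simp add: U_def)
  qed
  moreover have "\<pi> k u \<in> U" if k: "k \<in> K" and u: "u \<in> U" for k u
  proof -
    have "\<pi> z (\<pi> k u) = \<pi> k (\<pi> z u)"
      using mult[OF z(1) k, of u] mult[OF k z(1), of u] central[of k] k KG by auto
    then show ?thesis using u lin[OF k] by (simp add: U_def linear_between_def)
  qed
  moreover have "U \<noteq> {0}" using v by (auto simp: U_def)
  moreover have "U = {0} \<or> U = UNIV"
    if "subspace U" "\<forall>Z\<in>cplx_lie_algebra G. \<forall>u\<in>U. \<alpha> Z u \<in> U" "\<forall>k\<in>K. \<forall>u\<in>U. \<pi> k u \<in> U"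
    using irr that unfolding irreducible_gK_module_def by fast
  ultimately have "U = UNIV" by simp
  then show ?thesis unfolding U_def by fast
qed

section \<open>Transport along the identification and conclusion\<close>

lemma identification_central_element:
  assumes mc: "maximal_compact_subgroup K G" and id: "classical_identification cs \<theta> G K"
  defines "z \<equiv> \<theta> (K_embed cs (minus_one_tuple cs))"
  shows "K \<subseteq> G" "z \<in> K" "invertible z" "\<And>g. g \<in> G \<Longrightarrow> z ** g = g ** z"
proof -
  let ?z = "K_embed cs (minus_one_tuple cs)"
  show KG: "K \<subseteq> G"
    using mc subgroup.subset unfolding maximal_compact_subgroup_def rmat_group_def by force
  show zK: "z \<in> K"
    using id minus_one_tuple_carrier by (auto simp: classical_identification_def z_def)
  have hom: "\<And>x y. x \<in> carrier (G_product cs) \<Longrightarrow> y \<in> carrier (G_product cs) \<Longrightarrow>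
      \<theta> (x \<otimes>\<^bsub>G_product cs\<^esub> y) = \<theta> x ** \<theta> y"
    and onto: "\<theta> ` carrier (G_product cs) = G"
    using id by (auto simp: classical_identification_def iso_def hom_def rmat_group_def bij_betw_def)
  note zc = K_embed_minus_one_carrier[of cs]
  show central: "z ** g = g ** z" if "g \<in> G" for g
    using that onto hom[OF zc] hom[OF _ zc] K_embed_minus_one_central unfolding z_def by force
  \<comment> \<open>That \<open>\<theta>\<close> preserves the identity is derived from
    multiplicativity and surjectivity: a preimage \<open>e\<close> of \<open>mat 1\<close> satisfies
    \<open>1 * e = e\<close> in the product.\<close>
  have "mat 1 \<in> G"
    using mc KG subgroup.one_closed
    unfolding maximal_compact_subgroup_def rmat_group_def by fastforce
  then obtain e where e: "e \<in> carrier (G_product cs)" "\<theta> e = mat 1" using onto by auto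
  have "\<one>\<^bsub>G_product cs\<^esub> \<otimes>\<^bsub>G_product cs\<^esub> e = e"
    using e(1) classical_set_carrier
    by (fastforce simp: G_product_def classical_group_def cmat_group_def PiE_iff extensional_def
        intro!: ext)
  then have "\<theta> \<one>\<^bsub>G_product cs\<^esub> = mat 1"
    using hom[OF G_product_one_carrier e(1)] e(2) by simp
  then have "z ** z = mat 1"
    using hom[OF zc zc] by (simp add: z_def K_embed_minus_one_square)
  then show "invertible z" unfolding invertible_def by blast
qed

theorem theorem2p6:
  fixes G G' K :: "(real^('n::finite + 'n)^('n + 'n)) set"
    and cs :: "classical list"
    and \<theta> :: "(nat \<Rightarrow> complex Matrix.mat) \<Rightarrow> real^('n + 'n)^('n + 'n)"
    and s :: "complex \<Rightarrow> 'v::ab_group_add \<Rightarrow> 'v"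
    and \<alpha> :: "complex^('n + 'n)^('n + 'n) \<Rightarrow> 'v \<Rightarrow> 'v"
    and \<pi> :: "real^('n + 'n)^('n + 'n) \<Rightarrow> 'v \<Rightarrow> 'v"
    and \<sigma> \<sigma>' :: "(real^('n + 'n)^('n + 'n)) crep set"
    and e e' :: bit
  assumes "reductive_dual_pair G G'"
    and "maximal_compact_subgroup K G"
    and "classical_identification cs \<theta> G K"
    and "irreducible_gK_module G K s \<alpha> \<pi>"
    and "\<sigma> \<in> K_types_of K s \<pi>" and "\<sigma>' \<in> K_types_of K s \<pi>"
    and "has_parity cs \<theta> \<sigma> e" and "has_parity cs \<theta> \<sigma>' e'"
  shows "e = e'"
proof -
  define z where "z = \<theta> (K_embed cs (minus_one_tuple cs))"
  note z = identification_central_element[OF assms(2,3), folded z_def]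
  have eigenvector: "\<exists>v. v \<noteq> 0 \<and> \<pi> z v = s (bit_sign d) v"
    if \<tau>: "\<tau> \<in> K_types_of K s \<pi>" and par: "has_parity cs \<theta> \<tau> d"
    for \<tau> :: "(real^('n + 'n)^('n + 'n)) crep set" and d
  proof -
    have \<tau>K: "\<tau> \<in> K_types (rmat_group K) (top_of_set K)" using \<tau> by (simp add: K_types_of_def)
    obtain W \<rho> R f where W: "(W, \<rho>) \<in> \<tau>"
      and tp: "is_tensor_product (K_index cs) (\<lambda>x. compact_group (K_factor cs x)) R
          (W, \<lambda>k. \<rho> (\<theta> (K_embed cs k)))"
      and f: "\<forall>x\<in>K_index cs. factor_parity (K_factor cs x) (R x) (f x)"
      and d: "d = (\<Sum>x\<in>K_index cs. f x)"
      using par unfolding has_parity_def by auto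
    \<comment> \<open>Parity and occurrence in the module may be witnessed by different
      representatives of \<open>\<tau>\<close>; \<open>K_type_scalar\<close> carries the sign from
      one to the other.\<close>
    obtain W' \<rho>' T w where W': "(W', \<rho>') \<in> \<tau>" and T: "linear_between fscale W' s UNIV T"
      "\<And>k u. k \<in> K \<Longrightarrow> u \<in> W' \<Longrightarrow> T (\<rho>' k u) = \<pi> k (T u)" and w: "w \<in> W'" "T w \<noteq> 0"
      using \<tau> unfolding K_types_of_def by auto
    have "(W, \<rho>) \<in> irreps (rmat_group K) (top_of_set K)"
      using \<tau>K W unfolding K_types_def quotient_def by fast
    then have rep: "group_rep (rmat_group K) fscale W \<rho>"
      and irr: "irreducible_rep (rmat_group K) fscale W \<rho>"
      by (auto simp: irreps_def fd_continuous_rep_def)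
    have zK: "z \<in> carrier (rmat_group K)" using z(2) by (simp add: rmat_group_def)
    have "W \<noteq> {0}" "W \<noteq> {}"
      using rep irr vector_space_fscale
      by (auto simp: irreducible_rep_def group_rep_def module.subspace_def
          module_iff_vector_space)
    then obtain v where v: "v \<in> W" "v \<noteq> 0" "\<rho> z v = fscale (bit_sign d) v"
      using tensor_product_eigenvector[OF _ _ tp f] d z_def by auto
    \<comment> \<open>Centrality of \<open>z\<close> in \<open>K\<close> spreads the sign from the
      pure tensor to all of \<open>W\<close>.\<close>
    have "\<rho> z u = fscale (bit_sign d) u" if "u \<in> W" for u
      using irreducible_rep_central_scalar[OF vector_space_fscale rep irr zK _ v that] z(1,4)
      by (auto simp: rmat_group_def)
    from K_type_scalar[OF \<tau>K W W' zK this w(1)]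
    have "\<rho>' z w = fscale (bit_sign d) w" .
    then have "\<pi> z (T w) = s (bit_sign d) (T w)"
      using T(1) T(2)[OF z(2) w(1)] w(1) by (simp add: linear_between_def)
    then show ?thesis using w(2) by blast
  qed
  obtain v where v: "v \<noteq> 0" "\<pi> z v = s (bit_sign e) v" using eigenvector assms(5,7) by blast
  obtain v' where v': "v' \<noteq> 0" "\<pi> z v' = s (bit_sign e') v'" using eigenvector assms(6,8) by blast
  \<comment> \<open>The sign found at \<open>v\<close> holds on the whole module. Comparing at the
    nonzero \<open>v'\<close> forces the two signs to agree.\<close>
  have "s (bit_sign e) v' = s (bit_sign e') v'"
    using irreducible_gK_module_central_scalar[OF assms(4) z(2,3,1,4) v] v'(2) by simp
  moreover have "vector_space s"
    using assms(4) by (simp add: irreducible_gK_module_def gK_module_def)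
  ultimately show ?thesis
    using v'(1) vector_space.scale_right_imp_eq bit_sign_inject by metis
qed

end
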